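(* Let $\omega=1$ and let $k\ge2$ be an integer. Let $(\theta,\rho)$ be the solution of the flow (F) with admissible initial datum $(\theta_0,\rho_0)$. If $(\theta_0,\rho_0)$ describes a $k$-fold rotationally symmetric heterogeneous curve, then so does $(\theta(t,\cdot),\rho(t,\cdot))$ for all $t\in(0,\infty)$.
   Context: Fixed parameters: $L>0$, $\nu\in\mathbb{R}$, $\mu>0$, $\omega\in\mathbb{Z}$, $c_0\in\mathbb{R}$, and $\beta\in C^\infty(\mathbb{R})$ with $\beta>0$. A function $\theta:[0,L]\to\mathbb{R}$ is the inclination angle of the arc-length parametrized planar curve $\gamma(s)=\gamma(0)+\int_0^s(\cos\theta,\sin\theta)\,\mathrm{d}r$; $\rho:[0,L]\to\mathbb{R}$ is a density. The flow (F) is the initial boundary value problem $$\partial_t\theta=\partial_s\big(\beta(\rho)(\partial_s\theta-c_0)\big)+\lambda_{\theta1}\sin\theta-\lambda_{\theta2}\cos\theta,\qquad \partial_t\rho=\mu\,\partial_s^2\rho-\tfrac12\beta'(\rho)(\partial_s\theta-c_0)^2-\lambda_\rho$$ on $(0,T)\times[0,L]$, with boundary conditions $\theta(\cdot,L)-\theta(\cdot,0)=2\pi\omega$, $\rho(\cdot,L)=\rho(\cdot,0)$, $\partial_s\theta(\cdot,L)=\partial_s\theta(\cdot,0)$, $\partial_s\rho(\cdot,L)=\partial_s\rho(\cdot,0)$, and initial condition $(\theta,\rho)(0,\cdot)=(\theta_0,\rho_0)$. The nonlocal multipliers are $$\begin{pmatrix}\lambda_{\theta1}\\ \lambda_{\theta2}\end{pmatrix}(t)=\Pi^{-1}(\theta)\int_0^L\begin{pmatrix}\cos\theta\\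 \sin\theta\end{pmatrix}\partial_s\theta\,\beta(\rho)(\partial_s\theta-c_0)\,\mathrm{d}s,\quad \Pi(\theta)=\begin{pmatrix}\int_0^L\sin^2\theta\,\mathrm{d}s&-\int_0^L\cos\theta\sin\theta\,\mathrm{d}s\\-\int_0^L\cos\theta\sin\theta\,\mathrm{d}s&\int_0^L\cos^2\theta\,\mathrm{d}s\end{pmatrix},$$ $\lambda_\rho(t)=-\frac1{2L}\int_0^L\beta'(\rho)(\partial_s\theta-c_0)^2\,\mathrm{d}s$. An admissible initial datum is $(\theta_0,\rho_0)\in C^\infty([0,L])$ with $\int_0^L\rho_0\,\mathrm{d}s=\nu L$, $\int_0^L\sin\theta_0\,\mathrm{d}s=\int_0^L\cos\theta_0\,\mathrm{d}s=0$, $\theta_0(L)-\theta_0(0)=2\pi\omega$, $\rho_0(L)=\rho_0(0)$, and $\partial_s^j\theta_0(L)=\partial_s^j\theta_0(0)$, $\partial_s^j\rho_0(L)=\partial_s^j\rho_0(0)$ for $j=1,2$. By earlier work, for each admissible initial datum (F) has a unique global solution $(\theta,\rho)\in C^\infty((0,\infty)\times[0,L])\cap C^0([0,\infty);C^2([0,L]))$; for $t>0$ the functions $\partial_s\theta(t,\cdot)$ and $\rho(t,\cdot)$ extend to smooth $L$-periodic functions on $\mathbb{R}$. Rotational symmetry: let $\omega=1$, $\phi(s)=2\pi s/L$ and $k\in\mathbb{N}$, $k\ge2$. The heterogeneous curve described by $(\theta,\rho)\in C^\infty([0,L])$ is $k$-fold rotationally symmetric if the $L$-periodic extension of $(\theta-\phi,\rho)$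 to $\mathbb{R}$ is $\frac Lk$-periodic. *)

theory Defs
  imports "HOL-Analysis.Analysis"
begin

text \<open>
  Functions on \<open>[0,L]\<close> are total functions on the reals of which only the values on \<open>{0..L}\<close>
  matter: all derivatives in \<open>s\<close> are taken within \<open>{0..L}\<close>, hence are one-sided at \<open>0\<close> and \<open>L\<close>.
  Functions of time and arc length take the time argument first.
\<close>

definition ds :: "real \<Rightarrow> (real \<Rightarrow> real) \<Rightarrow> real \<Rightarrow> real" where
  "ds L f = (\<lambda>s. vector_derivative f (at s within {0..L}))"

definition dt :: "(real \<Rightarrow> real \<Rightarrow> real) \<Rightarrow> real \<Rightarrow> real \<Rightarrow> real" where
  "dt f = (\<lambda>t s. deriv (\<lambda>\<tau>. f \<tau> s) t)"

definition smooth_real :: "(real \<Rightarrow> real) \<Rightarrow> bool" where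
  "smooth_real f \<longleftrightarrow> (\<forall>n x. (deriv ^^ n) f differentiable (at x))"

definition smooth_interval :: "real \<Rightarrow> (real \<Rightarrow> real) \<Rightarrow> bool" where
  "smooth_interval L f \<longleftrightarrow> (\<forall>n. \<forall>s\<in>{0..L}. (ds L ^^ n) f differentiable (at s within {0..L}))"

definition C2_interval :: "real \<Rightarrow> (real \<Rightarrow> real) \<Rightarrow> bool" where
  "C2_interval L f \<longleftrightarrow>
     (\<forall>n<2. \<forall>s\<in>{0..L}. (ds L ^^ n) f differentiable (at s within {0..L})) \<and>
     continuous_on {0..L} ((ds L ^^ 2) f)"

text \<open>
  \<open>C\<^sup>n((0,\<infinity>) \<times> [0,L])\<close>: all mixed partial derivatives up to order \<open>n\<close>, in every order of
  differentiation, exist and are jointly continuous.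
\<close>

primrec Cn_strip :: "nat \<Rightarrow> real \<Rightarrow> (real \<Rightarrow> real \<Rightarrow> real) \<Rightarrow> bool" where
  "Cn_strip 0 L f \<longleftrightarrow> continuous_on ({0<..} \<times> {0..L}) (\<lambda>(t, s). f t s)"
| "Cn_strip (Suc n) L f \<longleftrightarrow>
     continuous_on ({0<..} \<times> {0..L}) (\<lambda>(t, s). f t s) \<and>
     (\<forall>t>0. \<forall>s\<in>{0..L}. (\<lambda>\<tau>. f \<tau> s) differentiable (at t) \<and>
                       f t differentiable (at s within {0..L})) \<and>
     Cn_strip n L (dt f) \<and> Cn_strip n L (\<lambda>t. ds L (f t))"

definition smooth_strip :: "real \<Rightarrow> (real \<Rightarrow> real \<Rightarrow> real) \<Rightarrow> bool" where
  "smooth_strip L f \<longleftrightarrow> (\<forall>n. Cn_strip n L f)"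

text \<open>
  \<open>C\<^sup>0([0,\<infinity>); C\<^sup>2([0,L]))\<close>: continuity into the Banach space \<open>C\<^sup>2([0,L])\<close> is uniform
  convergence on \<open>[0,L]\<close> of the derivatives of order \<open>0\<close>, \<open>1\<close>, \<open>2\<close>.
\<close>

definition C0_time_C2 :: "real \<Rightarrow> (real \<Rightarrow> real \<Rightarrow> real) \<Rightarrow> bool" where
  "C0_time_C2 L f \<longleftrightarrow>
     (\<forall>t\<ge>0. C2_interval L (f t)) \<and>
     (\<forall>t\<^sub>0\<ge>0. \<forall>j\<le>2. uniform_limit {0..L} (\<lambda>t. (ds L ^^ j) (f t)) ((ds L ^^ j) (f t\<^sub>0))
                       (at t\<^sub>0 within {0..}))"

text \<open>
  The matrix \<open>\<Pi>(\<theta>)\<close> and the multipliers at a fixed time, where \<open>\<theta>\<close> and \<open>\<rho>\<close> are functions of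
  \<open>s\<close> alone. The components of \<open>lambda_theta\<close> are \<open>\<lambda>\<^sub>\<theta>\<^sub>1\<close> and \<open>\<lambda>\<^sub>\<theta>\<^sub>2\<close>.
\<close>

definition Pi_mat :: "real \<Rightarrow> (real \<Rightarrow> real) \<Rightarrow> real ^ 2 ^ 2" where
  "Pi_mat L \<theta> = vector
     [vector [integral {0..L} (\<lambda>s. (sin (\<theta> s))\<^sup>2), - integral {0..L} (\<lambda>s. cos (\<theta> s) * sin (\<theta> s))],
      vector [- integral {0..L} (\<lambda>s. cos (\<theta> s) * sin (\<theta> s)), integral {0..L} (\<lambda>s. (cos (\<theta> s))\<^sup>2)]]"

definition lambda_theta ::
  "real \<Rightarrow> real \<Rightarrow> (real \<Rightarrow> real) \<Rightarrow> (real \<Rightarrow> real) \<Rightarrow> (real \<Rightarrow> real) \<Rightarrow> real ^ 2" where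
  "lambda_theta L c\<^sub>0 \<beta> \<theta> \<rho> = matrix_inv (Pi_mat L \<theta>) *v vector
     [integral {0..L} (\<lambda>s. cos (\<theta> s) * ds L \<theta> s * \<beta> (\<rho> s) * (ds L \<theta> s - c\<^sub>0)),
      integral {0..L} (\<lambda>s. sin (\<theta> s) * ds L \<theta> s * \<beta> (\<rho> s) * (ds L \<theta> s - c\<^sub>0))]"

definition lambda_rho ::
  "real \<Rightarrow> real \<Rightarrow> (real \<Rightarrow> real) \<Rightarrow> (real \<Rightarrow> real) \<Rightarrow> (real \<Rightarrow> real) \<Rightarrow> real" where
  "lambda_rho L c\<^sub>0 \<beta> \<theta> \<rho> =
     - (1 / (2 * L)) * integral {0..L} (\<lambda>s. deriv \<beta> (\<rho> s) * (ds L \<theta> s - c\<^sub>0)\<^sup>2)"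

definition admissible_datum ::
  "real \<Rightarrow> real \<Rightarrow> int \<Rightarrow> (real \<Rightarrow> real) \<Rightarrow> (real \<Rightarrow> real) \<Rightarrow> bool" where
  "admissible_datum L \<nu> \<omega> \<theta>\<^sub>0 \<rho>\<^sub>0 \<longleftrightarrow>
     smooth_interval L \<theta>\<^sub>0 \<and> smooth_interval L \<rho>\<^sub>0 \<and>
     integral {0..L} \<rho>\<^sub>0 = \<nu> * L \<and>
     integral {0..L} (\<lambda>s. sin (\<theta>\<^sub>0 s)) = 0 \<and>
     integral {0..L} (\<lambda>s. cos (\<theta>\<^sub>0 s)) = 0 \<and>
     \<theta>\<^sub>0 L - \<theta>\<^sub>0 0 = 2 * pi * of_int \<omega> \<and> \<rho>\<^sub>0 L = \<rho>\<^sub>0 0 \<and>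
     (\<forall>j\<in>{1, 2}. (ds L ^^ j) \<theta>\<^sub>0 L = (ds L ^^ j) \<theta>\<^sub>0 0 \<and>
                 (ds L ^^ j) \<rho>\<^sub>0 L = (ds L ^^ j) \<rho>\<^sub>0 0)"

text \<open>Global solutions of the flow, i.e. solutions on \<open>(0,\<infinity>) \<times> [0,L]\<close>.\<close>

definition flow_solution ::
  "real \<Rightarrow> real \<Rightarrow> int \<Rightarrow> real \<Rightarrow> (real \<Rightarrow> real) \<Rightarrow> (real \<Rightarrow> real) \<Rightarrow> (real \<Rightarrow> real) \<Rightarrow>
   (real \<Rightarrow> real \<Rightarrow> real) \<Rightarrow> (real \<Rightarrow> real \<Rightarrow> real) \<Rightarrow> bool" where
  "flow_solution L \<mu> \<omega> c\<^sub>0 \<beta> \<theta>\<^sub>0 \<rho>\<^sub>0 \<theta> \<rho> \<longleftrightarrow>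
     smooth_strip L \<theta> \<and> C0_time_C2 L \<theta> \<and> smooth_strip L \<rho> \<and> C0_time_C2 L \<rho> \<and>
     (\<forall>t>0. \<forall>s\<in>{0..L}.
        dt \<theta> t s = ds L (\<lambda>r. \<beta> (\<rho> t r) * (ds L (\<theta> t) r - c\<^sub>0)) s
          + lambda_theta L c\<^sub>0 \<beta> (\<theta> t) (\<rho> t) $ 1 * sin (\<theta> t s)
          - lambda_theta L c\<^sub>0 \<beta> (\<theta> t) (\<rho> t) $ 2 * cos (\<theta> t s) \<and>
        dt \<rho> t s = \<mu> * (ds L ^^ 2) (\<rho> t) s
          - 1 / 2 * deriv \<beta> (\<rho> t s) * (ds L (\<theta> t) s - c\<^sub>0)\<^sup>2
          - lambda_rho L c\<^sub>0 \<beta> (\<theta> t) (\<rho> t)) \<and>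
     (\<forall>t>0. \<theta> t L - \<theta> t 0 = 2 * pi * of_int \<omega> \<and> \<rho> t L = \<rho> t 0 \<and>
            ds L (\<theta> t) L = ds L (\<theta> t) 0 \<and> ds L (\<rho> t) L = ds L (\<rho> t) 0) \<and>
     (\<forall>s\<in>{0..L}. \<theta> 0 s = \<theta>\<^sub>0 s \<and> \<rho> 0 s = \<rho>\<^sub>0 s)"

definition is_periodic_extension :: "real \<Rightarrow> (real \<Rightarrow> real) \<Rightarrow> (real \<Rightarrow> real) \<Rightarrow> bool" where
  "is_periodic_extension L f g \<longleftrightarrow> (\<forall>s\<in>{0..L}. g s = f s) \<and> (\<forall>s. g (s + L) = g s)"

text \<open>
  For \<open>L > 0\<close> there is at most one \<open>L\<close>-periodic extension; it exists iff the values at \<open>0\<close> and \<open>L\<close>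
  agree, which for \<open>\<theta> - \<phi>\<close> means rotation index one.
\<close>

definition rotationally_symmetric :: "real \<Rightarrow> nat \<Rightarrow> (real \<Rightarrow> real) \<Rightarrow> (real \<Rightarrow> real) \<Rightarrow> bool" where
  "rotationally_symmetric L k \<theta> \<rho> \<longleftrightarrow>
     smooth_interval L \<theta> \<and> smooth_interval L \<rho> \<and>
     (\<exists>g h. is_periodic_extension L (\<lambda>s. \<theta> s - 2 * pi * s / L) g \<and>
            is_periodic_extension L \<rho> h \<and>
            (\<forall>s. g (s + L / real k) = g s) \<and> (\<forall>s. h (s + L / real k) = h s))"

end

theory Submission
  imports Defs
begin

text \<open>
  A curve is \<open>k\<close>-fold symmetric iff shifting the arc length by \<open>a = L/k\<close> and subtracting the angle
  \<open>2\<pi>/k\<close> does not change \<open>(\<theta>, \<rho>)\<close>. The shifted solution again solves the flow, so the claim is a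
  uniqueness statement, proved by a Gronwall estimate for the energy
  \<open>1/2 \<integral> (w\<^sup>2 + r\<^sup>2)\<close> of the differences \<open>w\<close>, \<open>r\<close> between the shifted and the original solution.
  The diffusion absorbs the first derivative of \<open>w\<close>; \<open>\<lambda>\<^sub>\<rho>\<close> is the same for both solutions. The multipliers
  \<open>\<lambda>\<^sub>\<theta>\<close> need only be bounded, not Lipschitz: both curves are closed, so
  \<open>\<integral> w sin \<theta> = - \<integral> (cos (\<theta> + w) - cos \<theta>) + O(\<integral> w\<^sup>2) = O(\<integral> w\<^sup>2)\<close>, and similarly for \<open>w cos \<theta>\<close>.
  The shift modulo \<open>L\<close> is split into the shift by \<open>a\<close> on \<open>[0, L - a]\<close> and by \<open>a - L\<close> on \<open>[L - a, L]\<close>;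
  the boundary terms of the two pieces cancel.
\<close>

section \<open>Smooth functions, integrals and elementary inequalities\<close>

lemma ds_has_real_derivative:
  assumes "f differentiable (at s within {0..L})"
  shows "(f has_real_derivative ds L f s) (at s within {0..L})"
  using assms unfolding ds_def has_real_derivative_iff_has_vector_derivative
  by (simp add: vector_derivative_works)

lemma dt_has_real_derivative:
  assumes "(\<lambda>\<tau>. f \<tau> s) differentiable (at t)"
  shows "((\<lambda>\<tau>. f \<tau> s) has_real_derivative dt f t s) (at t)"
  using assms unfolding dt_def by (simp add: DERIV_deriv_iff_real_differentiable)

text \<open>Each level of \<open>Cn_strip\<close> trades one order of smoothness for one derivative
  taken next to \<open>f\<close>. The induction hypothesis is therefore applied to the first
  derivative in arc length, which is why \<open>f\<close> is generalized.\<close>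

lemma Cn_strip_ds_funpow: "Cn_strip (n + m) L f \<Longrightarrow> Cn_strip m L (\<lambda>t. (ds L ^^ n) (f t))"
proof (induction n arbitrary: f)
  case (Suc n)
  then have "Cn_strip m L (\<lambda>t. (ds L ^^ n) (ds L (f t)))" by simp
  then show ?case by (simp add: funpow_swap1)
qed simp

lemma smooth_strip_imp_smooth_interval:
  assumes "smooth_strip L f" "0 < t"
  shows "smooth_interval L (f t)"
  unfolding smooth_interval_def
proof (intro allI ballI)
  fix n s assume "s \<in> {0..L}"
  have "Cn_strip (Suc 0) L (\<lambda>t. (ds L ^^ n) (f t))"
    using assms(1) Cn_strip_ds_funpow[of n "Suc 0"] unfolding smooth_strip_def by blast
  then show "(ds L ^^ n) (f t) differentiable (at s within {0..L})"
    using assms(2) \<open>s \<in> {0..L}\<close> by simp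
qed

text \<open>An e/2 argument: first move in time at a fixed point, where uniformity makes the rate
  independent of the point, then move in space at the fixed time \<open>t\<close>.\<close>

lemma continuous_on_uniform_family:
  fixes f :: "'a::metric_space \<Rightarrow> 'b::metric_space \<Rightarrow> 'c::metric_space"
  assumes lim: "\<And>t. t \<in> T \<Longrightarrow> uniform_limit S f (f t) (at t within T)"
    and cont: "\<And>t. t \<in> T \<Longrightarrow> continuous_on S (f t)"
  shows "continuous_on (T \<times> S) (\<lambda>(t, s). f t s)"
  unfolding continuous_on_iff
proof (intro ballI allI impI)
  fix x :: "'a \<times> 'b" and e :: real assume x: "x \<in> T \<times> S" and "0 < e"
  obtain t s where ts: "x = (t, s)" "t \<in> T" "s \<in> S" using x by auto
  have "\<forall>\<^sub>F \<tau> in at t within T. \<forall>s\<in>S. dist (f \<tau> s) (f t s) < e / 2"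
    using lim[OF ts(2)] half_gt_zero[OF \<open>0 < e\<close>] unfolding uniform_limit_iff by blast
  then obtain d where d: "0 < d"
    "\<And>\<tau> s. \<tau> \<in> T \<Longrightarrow> \<tau> \<noteq> t \<Longrightarrow> dist \<tau> t < d \<Longrightarrow> s \<in> S \<Longrightarrow> dist (f \<tau> s) (f t s) < e / 2"
    unfolding eventually_at by auto
  \<comment> \<open>The filter \<open>at t within T\<close> leaves out \<open>t\<close> itself;
    there the distance is zero.\<close>
  have d': "dist (f \<tau> s) (f t s) < e / 2" if "\<tau> \<in> T" "dist \<tau> t < d" "s \<in> S" for \<tau> s
    using d(2)[OF that(1) _ that(2,3)] \<open>0 < e\<close> by (cases "\<tau> = t") auto
  obtain c where c: "0 < c" "\<And>r. r \<in> S \<Longrightarrow> dist r s < c \<Longrightarrow> dist (f t r) (f t s) < e / 2"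
    using cont[OF ts(2)] ts(3) \<open>0 < e\<close> unfolding continuous_on_iff by (meson half_gt_zero)
  show "\<exists>d>0. \<forall>y\<in>T \<times> S. dist y x < d \<longrightarrow>
      dist (case y of (t, s) \<Rightarrow> f t s) (case x of (t, s) \<Rightarrow> f t s) < e"
  proof (intro exI[of _ "min c d"] conjI ballI impI)
    fix y assume y: "y \<in> T \<times> S" "dist y x < min c d"
    obtain \<tau> r where yr: "y = (\<tau>, r)" "\<tau> \<in> T" "r \<in> S" using y by auto
    have "dist \<tau> t < d" "dist r s < c"
      using y(2) dist_fst_le[of y x] dist_snd_le[of y x] unfolding yr ts by auto
    then have "dist (f \<tau> r) (f t r) < e / 2" "dist (f t r) (f t s) < e / 2"
      using d' c(2) yr by auto
    then show "dist (case y of (t, s) \<Rightarrow> f t s) (case x of (t, s) \<Rightarrow> f t s) < e"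
      unfolding yr ts using dist_triangle[of "f \<tau> r" "f t s" "f t r"] by simp
  qed (use c(1) d(1) in auto)
qed

text \<open>\<open>smooth_strip\<close> speaks of positive times only; this gives joint continuity
  down to time 0, so that compactness of the closed time interval yields uniform bounds. The energy
  and the multipliers contain derivatives in arc length of order at most one.\<close>

lemma C0_time_C2_continuous_on:
  assumes "C0_time_C2 L f" "j < 2"
  shows "continuous_on ({0..} \<times> {0..L}) (\<lambda>(t, s). (ds L ^^ j) (f t) s)"
proof (rule continuous_on_uniform_family)
  fix t :: real assume t: "t \<in> {0..}"
  show "uniform_limit {0..L} (\<lambda>t. (ds L ^^ j) (f t)) ((ds L ^^ j) (f t)) (at t within {0..})"
    using assms t unfolding C0_time_C2_def by simp
  have "(ds L ^^ j) (f t) differentiable_on {0..L}"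
    using assms t unfolding C0_time_C2_def C2_interval_def differentiable_on_def by simp
  then show "continuous_on {0..L} ((ds L ^^ j) (f t))"
    by (rule differentiable_imp_continuous_on)
qed

lemma smooth_real_has_derivative:
  "smooth_real f \<Longrightarrow> (f has_real_derivative deriv f x) (at x)"
  unfolding smooth_real_def
  by (metis DERIV_deriv_iff_real_differentiable funpow_0)

lemma smooth_real_deriv: "smooth_real f \<Longrightarrow> smooth_real (deriv f)"
  unfolding smooth_real_def by (metis comp_apply funpow_Suc_right)

lemma smooth_real_continuous_on: "smooth_real f \<Longrightarrow> continuous_on S f"
  by (meson DERIV_isCont continuous_at_imp_continuous_on smooth_real_has_derivative)

section \<open>Bounds on compact sets and pointwise inequalities\<close>

lemma continuous_on_compact_bound:
  fixes f :: "'a::topological_space \<Rightarrow> real"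
  assumes "compact S" "continuous_on S f"
  obtains K where "0 \<le> K" "\<And>x. x \<in> S \<Longrightarrow> \<bar>f x\<bar> \<le> K"
proof -
  have "bounded (f ` S)"
    using assms compact_continuous_image compact_imp_bounded by blast
  then obtain K where "0 < K" "\<forall>x\<in>S. \<bar>f x\<bar> \<le> K"
    unfolding bounded_pos by auto
  then show ?thesis using that[of K] by auto
qed

lemma continuous_on_compact_away_from_zero:
  fixes f :: "'a::topological_space \<Rightarrow> real"
  assumes "compact S" "continuous_on S f" "\<And>x. x \<in> S \<Longrightarrow> f x \<noteq> 0"
  obtains k where "0 < k" "\<And>x. x \<in> S \<Longrightarrow> k \<le> \<bar>f x\<bar>"
proof (cases "S = {}")
  case False
  have "continuous_on S (\<lambda>x. \<bar>f x\<bar>)"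
    using assms(2) by (intro continuous_intros)
  then obtain x where "x \<in> S" "\<forall>y\<in>S. \<bar>f x\<bar> \<le> \<bar>f y\<bar>"
    using continuous_attains_inf[OF assms(1) False] by blast
  then show ?thesis using that[of "\<bar>f x\<bar>"] assms(3) by auto
qed (use that[of 1] in auto)

lemma smooth_real_Lipschitz:
  assumes "smooth_real f"
  obtains K where "0 \<le> K"
    "\<And>x y. x \<in> {a..b} \<Longrightarrow> y \<in> {a..b} \<Longrightarrow> \<bar>f x - f y\<bar> \<le> K * \<bar>x - y\<bar>"
proof -
  obtain K where K: "0 \<le> K" "\<And>x. x \<in> {a..b} \<Longrightarrow> \<bar>deriv f x\<bar> \<le> K"
    using continuous_on_compact_bound[OF compact_Icc]
      smooth_real_continuous_on[OF smooth_real_deriv[OF assms]] by metis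
  have "\<bar>f x - f y\<bar> \<le> K * \<bar>x - y\<bar>" if "x \<in> {a..b}" "y \<in> {a..b}" for x y
    using field_differentiable_bound[of "{a..b}" f "deriv f" K x y] K(2) that
      smooth_real_has_derivative[OF assms]
    by (auto intro: has_field_derivative_at_within)
  then show ?thesis using that K(1) by blast
qed

lemma sin_cos_Lipschitz:
  fixes x y :: real
  shows "\<bar>sin x - sin y\<bar> \<le> \<bar>x - y\<bar>" "\<bar>cos x - cos y\<bar> \<le> \<bar>x - y\<bar>"
proof -
  show "\<bar>sin x - sin y\<bar> \<le> \<bar>x - y\<bar>"
    using field_differentiable_bound[of UNIV sin cos 1 x y]
    by (auto intro: derivative_eq_intros)
  show "\<bar>cos x - cos y\<bar> \<le> \<bar>x - y\<bar>"
    using field_differentiable_bound[of UNIV cos "\<lambda>x. - sin x" 1 x y]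
    by (auto intro!: derivative_eq_intros)
qed

text \<open>The mean value inequality for \<open>sin z - z * cos x\<close> on the segment from
  \<open>x\<close> to \<open>y\<close>: its derivative \<open>cos z - cos x\<close> is at most the
  length of the segment. The cosine is treated likewise.\<close>

lemma sin_cos_remainder:
  fixes x y :: real
  shows "\<bar>sin y - sin x - (y - x) * cos x\<bar> \<le> (y - x)\<^sup>2"
    and "\<bar>cos y - cos x + (y - x) * sin x\<bar> \<le> (y - x)\<^sup>2"
proof -
  have der: "((\<lambda>z. sin z - z * cos x) has_real_derivative cos z - cos x) (at z within S)"
    "((\<lambda>z. cos z + z * sin x) has_real_derivative - (sin z - sin x)) (at z within S)" for z S
    by (auto intro!: derivative_eq_intros)
  have bd: "\<bar>cos z - cos x\<bar> \<le> \<bar>y - x\<bar>" "\<bar>sin z - sin x\<bar> \<le> \<bar>y - x\<bar>"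
    if "z \<in> closed_segment x y" for z
    using sin_cos_Lipschitz[of z x] segment_bound(1)[OF that] by (auto simp: abs_minus_commute)
  show "\<bar>sin y - sin x - (y - x) * cos x\<bar> \<le> (y - x)\<^sup>2"
    using field_differentiable_bound[of "closed_segment x y" "\<lambda>z. sin z - z * cos x"
        "\<lambda>z. cos z - cos x" "\<bar>y - x\<bar>" y x] der(1) bd(1)
    by (auto simp: algebra_simps power2_eq_square)
  show "\<bar>cos y - cos x + (y - x) * sin x\<bar> \<le> (y - x)\<^sup>2"
    using field_differentiable_bound[of "closed_segment x y" "\<lambda>z. cos z + z * sin x"
        "\<lambda>z. - (sin z - sin x)" "\<bar>y - x\<bar>" y x] der(2) bd(2)
    by (auto simp: algebra_simps power2_eq_square abs_minus_commute)
qed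

text \<open>This is what makes bounded multipliers sufficient. With \<open>w = y - x\<close>, the
  differences \<open>m1 - l1\<close> and \<open>m2 - l2\<close> come with \<open>w * sin x\<close>
  and \<open>w * cos x\<close>, which are \<open>cos x - cos y\<close> and
  \<open>sin y - sin x\<close> up to order \<open>w\<close> squared. These leading terms stay
  explicit because they integrate to zero for closed curves. The constant 6 is 1 + 1 from the
  Lipschitz bounds with factors \<open>m1\<close>, \<open>m2\<close> and 2 + 2 from the remainders
  with factors \<open>m1 - l1\<close>, \<open>m2 - l2\<close>.\<close>

lemma multiplier_difference_bound:
  fixes x y l1 l2 m1 m2 M :: real
  assumes "\<bar>l1\<bar> \<le> M" "\<bar>l2\<bar> \<le> M" "\<bar>m1\<bar> \<le> M" "\<bar>m2\<bar> \<le> M"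
  shows "(y - x) * ((m1 * sin y - m2 * cos y) - (l1 * sin x - l2 * cos x))
    \<le> - (m1 - l1) * (cos y - cos x) - (m2 - l2) * (sin y - sin x) + 6 * M * (y - x)\<^sup>2"
proof -
  define w where "w = y - x"
  have le: "a * b \<le> N * w\<^sup>2" if "\<bar>a\<bar> \<le> N" "\<bar>b\<bar> \<le> w\<^sup>2" for a b N :: real
  proof -
    have "a * b \<le> \<bar>a\<bar> * \<bar>b\<bar>" by (simp add: abs_le_D1 flip: abs_mult)
    also have "\<dots> \<le> N * w\<^sup>2" using that by (intro mult_mono) auto
    finally show ?thesis .
  qed
  have sq: "\<bar>w * v\<bar> \<le> w\<^sup>2" if "\<bar>v\<bar> \<le> \<bar>w\<bar>" for v
    using mult_left_mono[OF that, of "\<bar>w\<bar>"] by (simp add: abs_mult power2_eq_square)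
  have 1: "m1 * (w * (sin y - sin x)) \<le> M * w\<^sup>2"
    using assms sin_cos_Lipschitz[of y x] by (intro le sq) (auto simp: w_def)
  have 2: "(- m2) * (w * (cos y - cos x)) \<le> M * w\<^sup>2"
    using assms sin_cos_Lipschitz[of y x] by (intro le sq) (auto simp: w_def)
  have 3: "(m1 - l1) * (cos y - cos x + w * sin x) \<le> 2 * M * w\<^sup>2"
    using assms sin_cos_remainder(2)[of y x] by (intro le) (auto simp: w_def)
  have 4: "(m2 - l2) * (sin y - sin x - w * cos x) \<le> 2 * M * w\<^sup>2"
    using assms sin_cos_remainder(1)[of y x] by (intro le) (auto simp: w_def)
  show ?thesis
    using 1 2 3 4 unfolding w_def[symmetric] by (simp add: algebra_simps)
qed

text \<open>
  The part of the energy density that is quadratic in the difference \<open>v - u\<close> of the first derivatives is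
  absorbed by Young's inequality.
\<close>

lemma parabolic_difference_bound:
  fixes u v b c b' c' r :: real
  assumes "0 < \<delta>" "\<delta> \<le> c" "\<bar>c - b\<bar> \<le> K * \<bar>r\<bar>" "\<bar>c' - b'\<bar> \<le> K * \<bar>r\<bar>" "\<bar>b'\<bar> \<le> K"
    and "\<bar>u\<bar> \<le> U" "\<bar>v\<bar> \<le> U" "0 \<le> K"
  shows "- (v - u) * (c * v - b * u) - 1 / 2 * r * (c' * v\<^sup>2 - b' * u\<^sup>2)
    \<le> ((K * U)\<^sup>2 / \<delta> + K * U\<^sup>2) * r\<^sup>2"
proof -
  define z where "z = v - u"
  define Q where "Q = \<bar>z\<bar> * (K * \<bar>r\<bar> * U)"
  have U: "0 \<le> U" using assms by linarith
  have "- (z * ((c - b) * u)) \<le> \<bar>z\<bar> * (\<bar>c - b\<bar> * \<bar>u\<bar>)"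
    by (metis abs_ge_minus_self abs_mult)
  also have "\<dots> \<le> Q"
    unfolding Q_def using assms U by (intro mult_left_mono mult_mono) auto
  finally have 1: "- (z * ((c - b) * u)) \<le> Q" .
  have "- (z * (r * b') * (v + u)) \<le> \<bar>z\<bar> * (\<bar>r\<bar> * \<bar>b'\<bar>) * \<bar>v + u\<bar>"
    by (metis abs_ge_minus_self abs_mult)
  also have "\<dots> \<le> \<bar>z\<bar> * (\<bar>r\<bar> * K) * (2 * U)"
    using assms U by (intro mult_left_mono mult_mono) auto
  finally have 2: "- (z * (r * b') * (v + u)) \<le> 2 * Q" by (simp add: Q_def mult_ac)
  have "- (r * (c' - b') * v\<^sup>2) \<le> \<bar>r\<bar> * \<bar>c' - b'\<bar> * \<bar>v\<bar>\<^sup>2"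
    by (metis abs_ge_minus_self abs_mult power_abs)
  also have "\<dots> \<le> \<bar>r\<bar> * (K * \<bar>r\<bar>) * U\<^sup>2"
    using assms U by (intro mult_left_mono mult_mono power_mono) auto
  also have "\<dots> = K * U\<^sup>2 * r\<^sup>2"
    by (simp add: power2_eq_square)
  finally have 3: "- (r * (c' - b') * v\<^sup>2) \<le> K * U\<^sup>2 * r\<^sup>2" .
  have 4: "\<delta> * z\<^sup>2 \<le> c * z\<^sup>2"
    using assms by (intro mult_right_mono) auto
  \<comment> \<open>Young's inequality as a completed square. The mixed terms add up to
    \<open>2 * Q\<close>: one \<open>Q\<close> from the flux and half of \<open>2 * Q\<close> from
    the density equation, so the coercive term \<open>\<delta> * z\<^sup>2\<close> absorbs all of
    them.\<close>
  have "0 \<le> (\<delta> * \<bar>z\<bar> - K * \<bar>r\<bar> * U)\<^sup>2 / \<delta>"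
    using assms by simp
  also have "\<dots> = \<delta> * z\<^sup>2 - 2 * Q + (K * U)\<^sup>2 / \<delta> * r\<^sup>2"
    using assms(1) unfolding Q_def by (simp add: power2_diff power_mult_distrib) (simp add: field_simps power2_eq_square)
  finally have 5: "2 * Q \<le> \<delta> * z\<^sup>2 + (K * U)\<^sup>2 / \<delta> * r\<^sup>2" by simp
  have 6: "0 \<le> K * U\<^sup>2 * r\<^sup>2" using assms by simp
  have "- (v - u) * (c * v - b * u) - 1 / 2 * r * (c' * v\<^sup>2 - b' * u\<^sup>2)
    = - (c * z\<^sup>2) - z * ((c - b) * u) - 1/2 * (r * (c' - b') * v\<^sup>2) - 1/2 * (z * (r * b') * (v + u))"
    unfolding z_def by (simp add: field_simps power2_eq_square)
  also have "\<dots> \<le> (K * U)\<^sup>2 / \<delta> * r\<^sup>2 + K * U\<^sup>2 * r\<^sup>2"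
    using 1 2 3 4 5 6 by linarith
  finally show ?thesis by (simp add: algebra_simps)
qed

text \<open>The function \<open>exp (- C * t) * E t\<close> is nonincreasing. The rate is asked for
  at interior times only, since the flow equations hold for positive times; continuity covers the
  end points.\<close>

lemma Gronwall_zero:
  fixes E :: "real \<Rightarrow> real"
  assumes "continuous_on {0..T} E" "E 0 \<le> 0" "0 \<le> T"
    and rate: "\<And>t. 0 < t \<Longrightarrow> t < T \<Longrightarrow> \<exists>D. (E has_real_derivative D) (at t) \<and> D \<le> C * E t"
  shows "E T \<le> 0"
proof -
  have "exp (- C * T) * E T \<le> exp (- C * 0) * E 0"
  proof (rule DERIV_nonpos_imp_decreasing_open[OF \<open>0 \<le> T\<close>])
    fix t assume "0 < t" "t < T"
    then obtain D where D: "(E has_real_derivative D) (at t)" "D \<le> C * E t"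
      using rate by blast
    have "((\<lambda>t. exp (- C * t) * E t) has_real_derivative exp (- C * t) * (D - C * E t)) (at t)"
      using D(1) by (auto intro!: derivative_eq_intros simp: algebra_simps)
    moreover have "exp (- C * t) * (D - C * E t) \<le> 0"
      using D(2) by (simp add: mult_le_0_iff)
    ultimately show "\<exists>y. ((\<lambda>t. exp (- C * t) * E t) has_real_derivative y) (at t) \<and> y \<le> 0"
      by blast
  qed (intro continuous_intros assms(1))
  also have "\<dots> \<le> 0" using assms(2) by simp
  finally show ?thesis by (simp add: mult_le_0_iff)
qed

section \<open>Integrals depending on time, and shifts of the argument\<close>

lemma integral_strip_has_derivative:
  fixes f f' :: "real \<Rightarrow> real \<Rightarrow> real"
  assumes "\<And>t s. 0 < t \<Longrightarrow> s \<in> {a..b} \<Longrightarrow> ((\<lambda>\<tau>. f \<tau> s) has_real_derivative f' t s) (at t)"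
    and "\<And>t. 0 < t \<Longrightarrow> continuous_on {a..b} (f t)"
    and "continuous_on ({0<..} \<times> {a..b}) (\<lambda>x. f' (fst x) (snd x))" and "0 < t"
  shows "((\<lambda>t. integral {a..b} (f t)) has_real_derivative integral {a..b} (f' t)) (at t)"
proof -
  have "((\<lambda>t. integral (cbox a b) (f t)) has_real_derivative integral (cbox a b) (f' t))
      (at t within {0<..})"
    using assms
    by (intro leibniz_rule_field_derivative)
      (auto intro: has_field_derivative_at_within integrable_continuous_real simp: case_prod_beta')
  then show ?thesis
    using \<open>0 < t\<close> by (simp add: at_within_open[of t "{0<..}"])
qed

lemma continuous_on_integral_strip:
  fixes f :: "real \<Rightarrow> real \<Rightarrow> real"
  assumes "continuous_on (T \<times> {a..b}) (\<lambda>x. f (fst x) (snd x))"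
  shows "continuous_on T (\<lambda>t. integral {a..b} (f t))"
  using integral_continuous_on_param[of T a b f] assms by (simp add: case_prod_beta')

lemma continuous_on_strip_shift:
  fixes f :: "real \<Rightarrow> real \<Rightarrow> real"
  assumes "continuous_on (T \<times> {0..L}) (\<lambda>x. f (fst x) (snd x))" "T' \<subseteq> T"
    and "\<And>s. s \<in> S \<Longrightarrow> s + d \<in> {0..L}"
  shows "continuous_on (T' \<times> S) (\<lambda>x. f (fst x) (snd x + d))"
proof -
  have "continuous_on (T' \<times> S) ((\<lambda>x. f (fst x) (snd x)) \<circ> (\<lambda>x. (fst x, snd x + d)))"
    using assms(2,3)
    by (intro continuous_on_compose continuous_on_subset[OF assms(1)] continuous_intros) auto
  then show ?thesis by (simp add: comp_def)
qed

lemma has_real_derivative_shift: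
  fixes f :: "real \<Rightarrow> real"
  assumes "(f has_real_derivative D) (at (s + d) within B)" "(\<lambda>s. s + d) ` A \<subseteq> B"
  shows "((\<lambda>s. f (s + d)) has_real_derivative D) (at s within A)"
proof -
  have "((\<lambda>s. s + d) has_real_derivative 1) (at s within A)"
    by (auto intro!: derivative_eq_intros)
  from DERIV_image_chain[OF DERIV_subset[OF assms] this] show ?thesis
    by (simp add: comp_def)
qed

lemma integral_shift_Icc:
  fixes f :: "real \<Rightarrow> real"
  shows "integral {a..b} (\<lambda>s. f (s + d)) = integral {a + d..b + d} f"
  using integral_shift_Icc_real[of a b f d] by (simp add: comp_def add.commute)

text \<open>By the intermediate value theorem \<open>f\<close> takes a value a quarter turn away
  from \<open>f a\<close>. The vectors (sin, - cos) at these two angles are orthogonal unit vectors,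
  so a vector perpendicular to both is zero.\<close>

lemma sin_cos_independent:
  fixes f :: "real \<Rightarrow> real"
  assumes "continuous_on {a..b} f" "a \<le> b" "pi / 2 \<le> \<bar>f b - f a\<bar>"
    and zero: "\<And>s. s \<in> {a..b} \<Longrightarrow> x * sin (f s) - y * cos (f s) = 0"
  shows "x = 0" "y = 0"
proof -
  obtain s where s: "s \<in> {a..b}" "f s = f a + pi / 2 \<or> f s = f a - pi / 2"
  proof (cases "f a \<le> f b")
    case True
    then obtain s where "a \<le> s" "s \<le> b" "f s = f a + pi / 2"
      using IVT'[of f a "f a + pi / 2" b] assms by auto
    then show ?thesis using that by auto
  next
    case False
    then obtain s where "a \<le> s" "s \<le> b" "f s = f a - pi / 2"
      using IVT2'[of f b "f a - pi / 2" a] assms by auto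
    then show ?thesis using that by auto
  qed
  have 1: "x * sin (f a) - y * cos (f a) = 0"
    using zero[of a] assms(2) by simp
  have 2: "x * cos (f a) + y * sin (f a) = 0"
    using zero[OF s(1)] s(2) by (auto simp: sin_add cos_add sin_diff cos_diff)
  have "x\<^sup>2 + y\<^sup>2 = (x\<^sup>2 + y\<^sup>2) * ((sin (f a))\<^sup>2 + (cos (f a))\<^sup>2)"
    by simp
  also have "\<dots> = (x * sin (f a) - y * cos (f a))\<^sup>2 + (x * cos (f a) + y * sin (f a))\<^sup>2"
    by algebra
  finally have "x\<^sup>2 + y\<^sup>2 = 0" using 1 2 by simp
  then show "x = 0" "y = 0" by (simp_all add: sum_power2_eq_zero_iff)
qed

text \<open>The expression is the Gram determinant of \<open>sin\<close> and \<open>cos\<close>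
  along \<open>f\<close> in the space of square integrable functions. Its quadratic form is the
  integral of \<open>(x * sin (f s) - y * cos (f s))\<^sup>2\<close>, which by
  \<open>sin_cos_independent\<close> vanishes for \<open>x = y = 0\<close> only.\<close>

lemma sin_cos_Gram_det_nonzero:
  fixes f :: "real \<Rightarrow> real"
  assumes "continuous_on {a..b} f" "a < b" "pi / 2 \<le> \<bar>f b - f a\<bar>"
  shows "integral {a..b} (\<lambda>s. (sin (f s))\<^sup>2) * integral {a..b} (\<lambda>s. (cos (f s))\<^sup>2)
    - (integral {a..b} (\<lambda>s. cos (f s) * sin (f s)))\<^sup>2 \<noteq> 0" (is "?S * ?C - ?X\<^sup>2 \<noteq> 0")
proof
  assume det: "?S * ?C - ?X\<^sup>2 = 0"
  have int: "(\<lambda>s. (sin (f s))\<^sup>2) integrable_on {a..b}" "(\<lambda>s. (cos (f s))\<^sup>2) integrable_on {a..b}"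
    "(\<lambda>s. cos (f s) * sin (f s)) integrable_on {a..b}"
    using assms(1) by (auto intro!: integrable_continuous_real continuous_intros)
  have zero: "x = 0 \<and> y = 0" if "x\<^sup>2 * ?S - 2 * x * y * ?X + y\<^sup>2 * ?C = 0" for x y
  proof -
    have "((\<lambda>s. x\<^sup>2 * (sin (f s))\<^sup>2 - 2 * x * y * (cos (f s) * sin (f s)) + y\<^sup>2 * (cos (f s))\<^sup>2)
        has_integral x\<^sup>2 * ?S - 2 * x * y * ?X + y\<^sup>2 * ?C) {a..b}"
      by (intro has_integral_add has_integral_diff has_integral_mult_right
          int[THEN integrable_integral])
    then have int0: "((\<lambda>s. (x * sin (f s) - y * cos (f s))\<^sup>2) has_integral 0) {a..b}"
      unfolding that by (simp add: power2_diff power_mult_distrib algebra_simps)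
    have cont: "continuous_on {a..b} (\<lambda>s. (x * sin (f s) - y * cos (f s))\<^sup>2)"
      by (intro continuous_intros assms(1))
    have "x * sin (f s) - y * cos (f s) = 0" if "s \<in> {a..b}" for s
      using integral_eq_0_iff[OF cont \<open>a < b\<close>] integral_unique[OF int0] that by simp
    then show ?thesis using sin_cos_independent[OF assms(1) less_imp_le[OF assms(2)] assms(3)] by blast
  qed
  \<comment> \<open>The form at the vector (\<open>?C\<close>, \<open>?X\<close>) is
    \<open>?C\<close> times the determinant. A zero determinant thus forces \<open>?C = 0\<close>,
    and then (0, 1) is a nonzero null vector.\<close>
  have "?C\<^sup>2 * ?S - 2 * ?C * ?X * ?X + ?X\<^sup>2 * ?C = ?C * (?S * ?C - ?X\<^sup>2)"
    by algebra
  then have "?C = 0" using zero[of ?C ?X] det by simp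
  then show False using zero[of 0 1] by simp
qed

text \<open>\<open>matrix_inv\<close> is a Hilbert choice; it is a genuine two-sided inverse as soon
  as one exists.\<close>

lemma matrix_inv_vector_mult:
  fixes A :: "real ^ 'n ^ 'n"
  assumes "det A \<noteq> 0"
  shows "A *v (matrix_inv A *v v) = v"
proof -
  have "\<exists>A'. A ** A' = mat 1 \<and> A' ** A = mat 1"
    using assms unfolding invertible_det_nz[symmetric] invertible_def .
  then have "A ** matrix_inv A = mat 1 \<and> matrix_inv A ** A = mat 1"
    unfolding matrix_inv_def by (rule someI_ex)
  then show ?thesis by (simp add: matrix_vector_mul_assoc)
qed

section \<open>Cyclic shifts and periodic extensions\<close>

lemma integral_cyclic_shift:
  fixes g :: "real \<Rightarrow> real"
  assumes "0 \<le> a" "a \<le> L" "continuous_on {0..L} g"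
  shows "integral {0..L - a} (\<lambda>s. g (s + a)) + integral {L - a..L} (\<lambda>s. g (s + (a - L)))
    = integral {0..L} g"
proof -
  have "integral {0..L - a} (\<lambda>s. g (s + a)) = integral {a..L} g"
    "integral {L - a..L} (\<lambda>s. g (s + (a - L))) = integral {0..a} g"
    by (simp_all add: integral_shift_Icc)
  then show ?thesis
    using Henstock_Kurzweil_Integration.integral_combine[OF assms(1,2) integrable_continuous_real[OF assms(3)]] by simp
qed

text \<open>The extension evaluates \<open>f\<close> at the representative of \<open>s\<close>
  modulo \<open>L\<close> in the half-open period. A shift by \<open>a\<close> moves this
  representative by \<open>a\<close>, or by \<open>a - L\<close> if it leaves the period; the two
  hypotheses on \<open>f\<close> treat these two cases.\<close>

lemma periodic_extension_exists:
  fixes f :: "real \<Rightarrow> real"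
  assumes "0 < a" "a < L" "f L = f 0"
    and "\<And>s. s \<in> {0..L - a} \<Longrightarrow> f (s + a) = f s"
    and "\<And>s. s \<in> {L - a..L} \<Longrightarrow> f (s + (a - L)) = f s"
  obtains g where "is_periodic_extension L f g" "\<And>s. g (s + a) = g s"
proof
  define g where "g s = f (L * frac (s / L))" for s
  have "g s = f s" if "s \<in> {0..L}" for s
  \<comment> \<open>The representative of \<open>L\<close> is 0, so the right end point relies on
    \<open>f L = f 0\<close>.\<close>
  proof (cases "s = L")
    case False
    then have "frac (s / L) = s / L" using that assms(1-3) by (simp add: frac_eq)
    then show ?thesis using assms(1-3) by (simp add: g_def)
  qed (use assms(1-3) in \<open>simp add: g_def\<close>)
  moreover have "g (s + L) = g s" for s
    using assms(1-3) by (simp add: g_def add_divide_distrib frac_1_eq)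
  ultimately show "is_periodic_extension L f g" by (simp add: is_periodic_extension_def)
  show "g (s + a) = g s" for s
  proof -
    define x where "x = L * frac (s / L)"
    have x: "0 \<le> x" "x < L" "frac (s / L) = x / L"
      using assms(1-3) frac_lt_1[of "s / L"] by (simp_all add: x_def)
    have gs: "g s = f x" by (simp add: g_def x_def)
    have "frac (a / L) = a / L" using assms(1-3) by (simp add: frac_eq)
    moreover have "x / L + a / L < 1 \<longleftrightarrow> x + a < L"
      using assms(1-3) by (simp add: field_simps)
    ultimately have frac: "frac ((s + a) / L) = (if x + a < L then (x + a) / L else (x + a) / L - 1)"
      by (simp add: add_divide_distrib frac_add x)
    show ?thesis
    proof (cases "x + a < L")
      case True
      then have "g (s + a) = f (x + a)" using assms(1-3) frac by (simp add: g_def)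
      also have "\<dots> = g s" using True x(1,2) assms(4)[of x] gs by simp
      finally show ?thesis .
    next
      case False
      then have "g (s + a) = f (x + (a - L))"
        using assms(1-3) frac by (simp add: g_def right_diff_distrib add_diff_eq)
      also have "\<dots> = g s" using False x(1,2) assms(5)[of x] gs by simp
      finally show ?thesis .
    qed
  qed
qed

text \<open>The converse passage: on the last piece, \<open>L\<close>-periodicity replaces the shift
  by \<open>a\<close> with the shift by \<open>a - L\<close>, which stays inside the
  interval.\<close>

lemma periodic_extension_shift:
  assumes "is_periodic_extension L f g" "\<And>s. g (s + a) = g s" "0 \<le> a" "a \<le> L"
  shows "s \<in> {0..L - a} \<Longrightarrow> f (s + a) = f s" "s \<in> {L - a..L} \<Longrightarrow> f (s + (a - L)) = f s"
proof -
  have g: "\<And>s. s \<in> {0..L} \<Longrightarrow> g s = f s" "\<And>s. g (s + L) = g s"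
    using assms(1) by (auto simp: is_periodic_extension_def)
  show "f (s + a) = f s" if "s \<in> {0..L - a}"
    using that g(1)[of s] g(1)[of "s + a"] assms by simp
  show "f (s + (a - L)) = f s" if "s \<in> {L - a..L}"
    using that g(1)[of s] g(1)[of "s + (a - L)"] g(2)[of "s + (a - L)"] assms(2)[of s] assms(3,4)
    by simp
qed

section \<open>Multipliers and closedness\<close>

text \<open>A nonzero rotation number makes the angle vary by at least 2 pi, which keeps the matrix
  of the multipliers invertible. Closedness is assumed at time 0 only; \<open>closed\<close>
  propagates it.\<close>

locale closed_curve_flow =
  fixes L \<mu> c\<^sub>0 :: real and \<omega> :: int
    and \<beta> \<theta>\<^sub>0 \<rho>\<^sub>0 :: "real \<Rightarrow> real" and \<theta> \<rho> :: "real \<Rightarrow> real \<Rightarrow> real"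
  assumes L_pos: "0 < L" and mu_pos: "0 < \<mu>" and omega_nonzero: "\<omega> \<noteq> 0"
    and beta_smooth: "smooth_real \<beta>" and beta_pos: "\<And>x. 0 < \<beta> x"
    and solution: "flow_solution L \<mu> \<omega> c\<^sub>0 \<beta> \<theta>\<^sub>0 \<rho>\<^sub>0 \<theta> \<rho>"
    and initial_rotation: "\<theta>\<^sub>0 L - \<theta>\<^sub>0 0 = 2 * pi * of_int \<omega>"
    and initially_closed: "integral {0..L} (\<lambda>s. sin (\<theta>\<^sub>0 s)) = 0"
      "integral {0..L} (\<lambda>s. cos (\<theta>\<^sub>0 s)) = 0"
begin

abbreviation "\<theta>\<^sub>s \<equiv> \<lambda>t. ds L (\<theta> t)"
abbreviation "\<rho>\<^sub>s \<equiv> \<lambda>t. ds L (\<rho> t)"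
abbreviation "l1 \<equiv> \<lambda>t. lambda_theta L c\<^sub>0 \<beta> (\<theta> t) (\<rho> t) $ 1"
abbreviation "l2 \<equiv> \<lambda>t. lambda_theta L c\<^sub>0 \<beta> (\<theta> t) (\<rho> t) $ 2"

definition flux :: "real \<Rightarrow> real \<Rightarrow> real" where
  "flux t = (\<lambda>s. \<beta> (\<rho> t s) * (\<theta>\<^sub>s t s - c\<^sub>0))"

section \<open>Regularity, boundary conditions and equations of the solution\<close>

lemma smooth: "smooth_strip L \<theta>" "smooth_strip L \<rho>"
  using solution unfolding flow_solution_def by blast+

lemma initial: "s \<in> {0..L} \<Longrightarrow> \<theta> 0 s = \<theta>\<^sub>0 s" "s \<in> {0..L} \<Longrightarrow> \<rho> 0 s = \<rho>\<^sub>0 s"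
  using solution unfolding flow_solution_def by blast+

lemma boundary:
  assumes "0 < t"
  shows "\<theta> t L = \<theta> t 0 + 2 * pi * of_int \<omega>" "\<rho> t L = \<rho> t 0"
    "\<theta>\<^sub>s t L = \<theta>\<^sub>s t 0" "\<rho>\<^sub>s t L = \<rho>\<^sub>s t 0"
  using solution assms unfolding flow_solution_def by (auto simp: algebra_simps)

text \<open>The boundary conditions of the flow concern positive times; at time 0 the datum supplies
  the condition.\<close>

lemma rotation: "0 \<le> t \<Longrightarrow> \<theta> t L = \<theta> t 0 + 2 * pi * of_int \<omega>"
  using boundary(1)[of t] initial(1)[of L] initial(1)[of 0] initial_rotation L_pos
  by (cases "t = 0") auto

lemma theta_equation:
  assumes "0 < t" "s \<in> {0..L}"
  shows "dt \<theta> t s = ds L (flux t) s + (l1 t * sin (\<theta> t s) - l2 t * cos (\<theta> t s))"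
  using solution assms unfolding flow_solution_def flux_def by (simp add: algebra_simps)

lemma rho_equation:
  assumes "0 < t" "s \<in> {0..L}"
  shows "dt \<rho> t s = \<mu> * (ds L ^^ 2) (\<rho> t) s - 1 / 2 * deriv \<beta> (\<rho> t s) * (\<theta>\<^sub>s t s - c\<^sub>0)\<^sup>2
    - lambda_rho L c\<^sub>0 \<beta> (\<theta> t) (\<rho> t)"
  using solution assms unfolding flow_solution_def by blast

lemma continuous_on_strip:
  "continuous_on ({0..} \<times> {0..L}) (\<lambda>x. \<theta> (fst x) (snd x))"
  "continuous_on ({0..} \<times> {0..L}) (\<lambda>x. \<rho> (fst x) (snd x))"
  "continuous_on ({0..} \<times> {0..L}) (\<lambda>x. \<theta>\<^sub>s (fst x) (snd x))"
proof -
  have C: "C0_time_C2 L \<theta>" "C0_time_C2 L \<rho>"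
    using solution unfolding flow_solution_def by blast+
  show "continuous_on ({0..} \<times> {0..L}) (\<lambda>x. \<theta> (fst x) (snd x))"
    using C0_time_C2_continuous_on[OF C(1), of 0] by (simp add: case_prod_beta')
  show "continuous_on ({0..} \<times> {0..L}) (\<lambda>x. \<rho> (fst x) (snd x))"
    using C0_time_C2_continuous_on[OF C(2), of 0] by (simp add: case_prod_beta')
  show "continuous_on ({0..} \<times> {0..L}) (\<lambda>x. \<theta>\<^sub>s (fst x) (snd x))"
    using C0_time_C2_continuous_on[OF C(1), of 1] by (simp add: case_prod_beta')
qed

lemma continuous_on_slice:
  assumes "0 \<le> t"
  shows "continuous_on {0..L} (\<theta> t)" "continuous_on {0..L} (\<rho> t)" "continuous_on {0..L} (\<theta>\<^sub>s t)"
proof -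
  have "continuous_on {0..L} (Pair t)" "Pair t ` {0..L} \<subseteq> {0..} \<times> {0..L}"
    using assms by (auto intro!: continuous_intros)
  from continuous_on_strip[THEN continuous_on_compose2, OF this]
  show "continuous_on {0..L} (\<theta> t)" "continuous_on {0..L} (\<rho> t)" "continuous_on {0..L} (\<theta>\<^sub>s t)"
    by simp_all
qed

lemma continuous_on_dt:
  "continuous_on ({0<..} \<times> {0..L}) (\<lambda>x. dt \<theta> (fst x) (snd x))"
  "continuous_on ({0<..} \<times> {0..L}) (\<lambda>x. dt \<rho> (fst x) (snd x))"
proof -
  have "Cn_strip (Suc 0) L \<theta>" "Cn_strip (Suc 0) L \<rho>"
    using smooth unfolding smooth_strip_def by blast+
  then show "continuous_on ({0<..} \<times> {0..L}) (\<lambda>x. dt \<theta> (fst x) (snd x))"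
    "continuous_on ({0<..} \<times> {0..L}) (\<lambda>x. dt \<rho> (fst x) (snd x))"
    by (simp_all add: case_prod_beta')
qed

lemma has_time_derivative:
  assumes "0 < t" "s \<in> {0..L}"
  shows "((\<lambda>\<tau>. \<theta> \<tau> s) has_real_derivative dt \<theta> t s) (at t)"
    and "((\<lambda>\<tau>. \<rho> \<tau> s) has_real_derivative dt \<rho> t s) (at t)"
proof -
  have "Cn_strip (Suc 0) L \<theta>" "Cn_strip (Suc 0) L \<rho>"
    using smooth unfolding smooth_strip_def by blast+
  then show "((\<lambda>\<tau>. \<theta> \<tau> s) has_real_derivative dt \<theta> t s) (at t)"
    "((\<lambda>\<tau>. \<rho> \<tau> s) has_real_derivative dt \<rho> t s) (at t)"
    using assms by (auto intro!: dt_has_real_derivative)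
qed

lemma has_space_derivative:
  assumes "0 < t" "s \<in> {0..L}"
  shows "(\<theta> t has_real_derivative \<theta>\<^sub>s t s) (at s within {0..L})"
    and "(\<rho> t has_real_derivative \<rho>\<^sub>s t s) (at s within {0..L})"
    and "(\<rho>\<^sub>s t has_real_derivative (ds L ^^ 2) (\<rho> t) s) (at s within {0..L})"
    and "(flux t has_real_derivative ds L (flux t) s) (at s within {0..L})"
proof -
  have C: "Cn_strip (Suc (Suc 0)) L \<theta>" "Cn_strip (Suc (Suc 0)) L \<rho>"
    using smooth unfolding smooth_strip_def by blast+
  have "\<theta> t differentiable (at s within {0..L})" "\<theta>\<^sub>s t differentiable (at s within {0..L})"
    "\<rho> t differentiable (at s within {0..L})" "\<rho>\<^sub>s t differentiable (at s within {0..L})"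
    using C assms by auto
  note der = this[THEN ds_has_real_derivative]
  show "(\<theta> t has_real_derivative \<theta>\<^sub>s t s) (at s within {0..L})"
    "(\<rho> t has_real_derivative \<rho>\<^sub>s t s) (at s within {0..L})"
    "(\<rho>\<^sub>s t has_real_derivative (ds L ^^ 2) (\<rho> t) s) (at s within {0..L})"
    using der by (simp_all add: numeral_2_eq_2)
  have "((\<lambda>s. \<beta> (\<rho> t s)) has_real_derivative deriv \<beta> (\<rho> t s) * \<rho>\<^sub>s t s) (at s within {0..L})"
    by (rule DERIV_chain2[OF smooth_real_has_derivative[OF beta_smooth] der(3)])
  from DERIV_mult[OF this DERIV_diff[OF der(2) DERIV_const[of c\<^sub>0]]]
  have "flux t differentiable (at s within {0..L})"
    unfolding flux_def real_differentiable_def by blast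
  then show "(flux t has_real_derivative ds L (flux t) s) (at s within {0..L})"
    by (rule ds_has_real_derivative)
qed

lemma continuous_on_flux: "0 \<le> t \<Longrightarrow> continuous_on {0..L} (flux t)"
  unfolding flux_def
  by (intro continuous_intros continuous_on_slice
      continuous_on_compose2[OF smooth_real_continuous_on[OF beta_smooth, of UNIV]]) auto

lemma flux_periodic: "0 < t \<Longrightarrow> flux t L = flux t 0"
  unfolding flux_def by (simp add: boundary)

abbreviation "sin_sin \<equiv> \<lambda>t. integral {0..L} (\<lambda>s. (sin (\<theta> t s))\<^sup>2)"
abbreviation "cos_cos \<equiv> \<lambda>t. integral {0..L} (\<lambda>s. (cos (\<theta> t s))\<^sup>2)"
abbreviation "cos_sin \<equiv> \<lambda>t. integral {0..L} (\<lambda>s. cos (\<theta> t s) * sin (\<theta> t s))"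
abbreviation "v1 \<equiv> \<lambda>t. integral {0..L} (\<lambda>s. cos (\<theta> t s) * \<theta>\<^sub>s t s * flux t s)"
abbreviation "v2 \<equiv> \<lambda>t. integral {0..L} (\<lambda>s. sin (\<theta> t s) * \<theta>\<^sub>s t s * flux t s)"
abbreviation "gram \<equiv> \<lambda>t. sin_sin t * cos_cos t - (cos_sin t)\<^sup>2"

text \<open>\<open>gram t\<close> is the determinant of \<open>\<Pi>(\<theta>)\<close> and \<open>(v1, v2)\<close> the vector to which its inverse is applied.\<close>

lemma gram_nonzero:
  assumes "0 \<le> t"
  shows "gram t \<noteq> 0"
proof (rule sin_cos_Gram_det_nonzero)
  have "1 \<le> \<bar>real_of_int \<omega>\<bar>"
    using omega_nonzero by linarith
  then have "pi / 2 * 1 \<le> 2 * pi * \<bar>of_int \<omega>\<bar>"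
    by (intro mult_mono) auto
  then show "pi / 2 \<le> \<bar>\<theta> t L - \<theta> t 0\<bar>"
    using rotation[OF assms] by (simp add: abs_mult)
qed (use assms L_pos continuous_on_slice in auto)

text \<open>The linear system behind the definition of the multipliers, row by row. It serves twice:
  Cramer's rule gives continuity in time, and each row is the conservation law of one closing
  integral.\<close>

lemma multiplier_equations:
  assumes "0 \<le> t"
  shows "sin_sin t * l1 t - cos_sin t * l2 t = v1 t" "cos_cos t * l2 t - cos_sin t * l1 t = v2 t"
proof -
  have "det (Pi_mat L (\<theta> t)) \<noteq> 0"
    using gram_nonzero[OF assms] by (simp add: Pi_mat_def det_2 power2_eq_square)
  then have "Pi_mat L (\<theta> t) *v lambda_theta L c\<^sub>0 \<beta> (\<theta> t) (\<rho> t) = vector [v1 t, v2 t]"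
    unfolding lambda_theta_def flux_def by (simp add: matrix_inv_vector_mult mult.assoc)
  then show "sin_sin t * l1 t - cos_sin t * l2 t = v1 t"
    "cos_cos t * l2 t - cos_sin t * l1 t = v2 t"
    by (auto simp: vec_eq_iff forall_2 matrix_vector_mult_def sum_2 Pi_mat_def)
qed

lemma continuous_on_multipliers: "continuous_on {0..} l1" "continuous_on {0..} l2"
proof -
  have strip: "continuous_on ({0..} \<times> {0..L}) (\<lambda>x. flux (fst x) (snd x))"
    unfolding flux_def
    by (intro continuous_intros continuous_on_strip
        continuous_on_compose2[OF smooth_real_continuous_on[OF beta_smooth, of UNIV]]) auto
  have cont: "continuous_on {0..} sin_sin" "continuous_on {0..} cos_cos" "continuous_on {0..} cos_sin"
    "continuous_on {0..} v1" "continuous_on {0..} v2"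
    by (intro continuous_on_integral_strip continuous_intros continuous_on_strip strip)+
  \<comment> \<open>Cramer's rule: all entries are integrals that depend continuously on time, and
    \<open>gram\<close> has no zero on \<open>{0..}\<close>.\<close>
  have l1: "l1 t = (cos_cos t * v1 t + cos_sin t * v2 t) / gram t"
    and l2: "l2 t = (cos_sin t * v1 t + sin_sin t * v2 t) / gram t" if "0 \<le> t" for t
    unfolding eq_divide_eq multiplier_equations[OF that, symmetric]
    using gram_nonzero[OF that] by (simp_all add: algebra_simps power2_eq_square)
  have quot: "continuous_on {0..} (\<lambda>t. (cos_cos t * v1 t + cos_sin t * v2 t) / gram t)"
    "continuous_on {0..} (\<lambda>t. (cos_sin t * v1 t + sin_sin t * v2 t) / gram t)"
    using gram_nonzero by (auto intro!: continuous_on_divide continuous_on_add continuous_on_diff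
        continuous_on_mult continuous_on_power cont)
  show "continuous_on {0..} l1"
    by (rule continuous_on_eq[OF quot(1)]) (simp only: l1 atLeast_iff)
  show "continuous_on {0..} l2"
    by (rule continuous_on_eq[OF quot(2)]) (simp only: l2 atLeast_iff)
qed

section \<open>Conservation of closedness\<close>

lemma continuous_on_theta_interior:
  "continuous_on ({0<..} \<times> {0..L}) (\<lambda>x. \<theta> (fst x) (snd x))"
  by (rule continuous_on_subset[OF continuous_on_strip(1)]) auto

text \<open>The multipliers are designed for this. Differentiate under the integral, insert the
  equation for \<open>\<theta>\<close> and integrate the flux term by parts. The boundary terms
  cancel, and what is left is one row of \<open>multiplier_equations\<close>.\<close>

lemma integral_sin_cos_theta_derivative:
  assumes "0 < t"
  shows "((\<lambda>\<tau>. integral {0..L} (\<lambda>s. cos (\<theta> \<tau> s))) has_real_derivative 0) (at t)"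
    and "((\<lambda>\<tau>. integral {0..L} (\<lambda>s. sin (\<theta> \<tau> s))) has_real_derivative 0) (at t)"
proof -
  note cont = continuous_on_slice[OF less_imp_le[OF assms]] continuous_on_flux[OF less_imp_le[OF assms]]
  have int: "((\<lambda>s. (sin (\<theta> t s))\<^sup>2) has_integral sin_sin t) {0..L}"
    "((\<lambda>s. (cos (\<theta> t s))\<^sup>2) has_integral cos_cos t) {0..L}"
    "((\<lambda>s. cos (\<theta> t s) * sin (\<theta> t s)) has_integral cos_sin t) {0..L}"
    "((\<lambda>s. cos (\<theta> t s) * \<theta>\<^sub>s t s * flux t s) has_integral v1 t) {0..L}"
    "((\<lambda>s. sin (\<theta> t s) * \<theta>\<^sub>s t s * flux t s) has_integral v2 t) {0..L}"
    by (intro integrable_integral integrable_continuous_real continuous_intros cont)+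
  \<comment> \<open>The flux is periodic, and the angles at the two ends differ by a multiple of 2
    pi.\<close>
  have bd: "sin (\<theta> t L) * flux t L - sin (\<theta> t 0) * flux t 0 = 0"
    "cos (\<theta> t L) * flux t L - cos (\<theta> t 0) * flux t 0 = 0"
    using boundary(1)[OF assms] flux_periodic[OF assms] sin_int_2pin[of \<omega>] cos_int_2pin[of \<omega>]
    by (simp_all add: sin_add cos_add)
  note sp = has_space_derivative[OF assms]
  have der: "((\<lambda>s. sin (\<theta> t s) * flux t s) has_vector_derivative
      cos (\<theta> t s) * \<theta>\<^sub>s t s * flux t s + ds L (flux t) s * sin (\<theta> t s)) (at s within {0..L})"
    "((\<lambda>s. cos (\<theta> t s) * flux t s) has_vector_derivative
      - sin (\<theta> t s) * \<theta>\<^sub>s t s * flux t s + ds L (flux t) s * cos (\<theta> t s)) (at s within {0..L})"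
    if "s \<in> {0..L}" for s
    unfolding has_real_derivative_iff_has_vector_derivative[symmetric]
    using DERIV_mult[OF DERIV_chain2[OF DERIV_sin sp(1)] sp(4)]
      DERIV_mult[OF DERIV_chain2[OF DERIV_cos sp(1)] sp(4)] that
    by blast+
  note ftc = fundamental_theorem_of_calculus[OF less_imp_le[OF L_pos] der(1), unfolded bd]
    fundamental_theorem_of_calculus[OF less_imp_le[OF L_pos] der(2), unfolded bd]
  \<comment> \<open>The integrand is written as a continuous function minus the exact derivative of
    \<open>sin (\<theta> t s) * flux t s\<close>, so the derivative of the flux is integrated
    through the fundamental theorem of calculus.\<close>
  have int1: "((\<lambda>s. cos (\<theta> t s) * \<theta>\<^sub>s t s * flux t s
      - (cos (\<theta> t s) * \<theta>\<^sub>s t s * flux t s + ds L (flux t) s * sin (\<theta> t s))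
      - l1 t * (sin (\<theta> t s))\<^sup>2 + l2 t * (cos (\<theta> t s) * sin (\<theta> t s))) has_integral
        v1 t - 0 - l1 t * sin_sin t + l2 t * cos_sin t) {0..L}"
    by (rule has_integral_add has_integral_diff has_integral_mult_right int ftc | assumption)+
  have zero1: "v1 t - 0 - l1 t * sin_sin t + l2 t * cos_sin t = 0"
    using multiplier_equations(1)[of t] assms by (simp add: mult.commute)
  have eq1: "- sin (\<theta> t s) * dt \<theta> t s = cos (\<theta> t s) * \<theta>\<^sub>s t s * flux t s
      - (cos (\<theta> t s) * \<theta>\<^sub>s t s * flux t s + ds L (flux t) s * sin (\<theta> t s))
      - l1 t * (sin (\<theta> t s))\<^sup>2 + l2 t * (cos (\<theta> t s) * sin (\<theta> t s))" if "s \<in> {0..L}" for s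
    unfolding theta_equation[OF assms that] by (simp add: algebra_simps power2_eq_square)
  have "((\<lambda>s. - sin (\<theta> t s) * dt \<theta> t s) has_integral 0) {0..L}"
    by (rule has_integral_eq[OF eq1[symmetric] int1[unfolded zero1]])
  then have "integral {0..L} (\<lambda>s. - sin (\<theta> t s) * dt \<theta> t s) = 0"
    by (rule integral_unique)
  moreover have "continuous_on ({0<..} \<times> {0..L}) (\<lambda>x. - sin (\<theta> (fst x) (snd x)) * dt \<theta> (fst x) (snd x))"
    by (intro continuous_intros continuous_on_theta_interior continuous_on_dt)
  ultimately show "((\<lambda>\<tau>. integral {0..L} (\<lambda>s. cos (\<theta> \<tau> s))) has_real_derivative 0) (at t)"
    using integral_strip_has_derivative[of 0 L "\<lambda>t s. cos (\<theta> t s)" "\<lambda>t s. - sin (\<theta> t s) * dt \<theta> t s",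
        OF DERIV_chain2[OF DERIV_cos has_time_derivative(1)]
          continuous_on_cos[OF continuous_on_slice(1)[OF less_imp_le]] _ assms]
    by (simp only:)
  have int2: "((\<lambda>s. sin (\<theta> t s) * \<theta>\<^sub>s t s * flux t s
      + (- sin (\<theta> t s) * \<theta>\<^sub>s t s * flux t s + ds L (flux t) s * cos (\<theta> t s))
      + l1 t * (cos (\<theta> t s) * sin (\<theta> t s)) - l2 t * (cos (\<theta> t s))\<^sup>2) has_integral
        v2 t + 0 + l1 t * cos_sin t - l2 t * cos_cos t) {0..L}"
    by (rule ftc has_integral_add has_integral_diff has_integral_mult_right int | assumption)+
  have zero2: "v2 t + 0 + l1 t * cos_sin t - l2 t * cos_cos t = 0"
    using multiplier_equations(2)[of t] assms by (simp add: mult.commute)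
  have eq2: "cos (\<theta> t s) * dt \<theta> t s = sin (\<theta> t s) * \<theta>\<^sub>s t s * flux t s
      + (- sin (\<theta> t s) * \<theta>\<^sub>s t s * flux t s + ds L (flux t) s * cos (\<theta> t s))
      + l1 t * (cos (\<theta> t s) * sin (\<theta> t s)) - l2 t * (cos (\<theta> t s))\<^sup>2" if "s \<in> {0..L}" for s
    unfolding theta_equation[OF assms that] by (simp add: algebra_simps power2_eq_square)
  have "((\<lambda>s. cos (\<theta> t s) * dt \<theta> t s) has_integral 0) {0..L}"
    by (rule has_integral_eq[OF eq2[symmetric] int2[unfolded zero2]])
  then have "integral {0..L} (\<lambda>s. cos (\<theta> t s) * dt \<theta> t s) = 0"
    by (rule integral_unique)
  moreover have "continuous_on ({0<..} \<times> {0..L}) (\<lambda>x. cos (\<theta> (fst x) (snd x)) * dt \<theta> (fst x) (snd x))"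
    by (intro continuous_intros continuous_on_theta_interior continuous_on_dt)
  ultimately show "((\<lambda>\<tau>. integral {0..L} (\<lambda>s. sin (\<theta> \<tau> s))) has_real_derivative 0) (at t)"
    using integral_strip_has_derivative[of 0 L "\<lambda>t s. sin (\<theta> t s)" "\<lambda>t s. cos (\<theta> t s) * dt \<theta> t s",
        OF DERIV_chain2[OF DERIV_sin has_time_derivative(1)]
          continuous_on_sin[OF continuous_on_slice(1)[OF less_imp_le]] _ assms]
    by (simp only:)
qed

lemma closed:
  assumes "0 \<le> t"
  shows "integral {0..L} (\<lambda>s. cos (\<theta> t s)) = 0" "integral {0..L} (\<lambda>s. sin (\<theta> t s)) = 0"
proof -
  have "continuous_on {0..} (\<lambda>t. integral {0..L} (\<lambda>s. cos (\<theta> t s)))"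
    "continuous_on {0..} (\<lambda>t. integral {0..L} (\<lambda>s. sin (\<theta> t s)))"
    by (intro continuous_on_integral_strip continuous_intros continuous_on_strip)+
  from this[THEN continuous_on_subset, of "{0..t}"]
  have cont: "continuous_on {0..t} (\<lambda>t. integral {0..L} (\<lambda>s. cos (\<theta> t s)))"
    "continuous_on {0..t} (\<lambda>t. integral {0..L} (\<lambda>s. sin (\<theta> t s)))"
    by auto
  have "integral {0..L} (\<lambda>s. cos (\<theta> 0 s)) = integral {0..L} (\<lambda>s. cos (\<theta>\<^sub>0 s))"
    "integral {0..L} (\<lambda>s. sin (\<theta> 0 s)) = integral {0..L} (\<lambda>s. sin (\<theta>\<^sub>0 s))"
    by (intro integral_cong; simp add: initial)+
  then have start: "integral {0..L} (\<lambda>s. cos (\<theta> 0 s)) = 0" "integral {0..L} (\<lambda>s. sin (\<theta> 0 s)) = 0"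
    using initially_closed by simp_all
  note der = integral_sin_cos_theta_derivative
  show "integral {0..L} (\<lambda>s. cos (\<theta> t s)) = 0"
  proof (cases "t = 0")
    case False
    then have "0 < t" using assms by simp
    from DERIV_isconst_end[OF this cont(1) der(1)] start(1) show ?thesis by simp
  qed (simp add: start)
  show "integral {0..L} (\<lambda>s. sin (\<theta> t s)) = 0"
  proof (cases "t = 0")
    case False
    then have "0 < t" using assms by simp
    from DERIV_isconst_end[OF this cont(2) der(2)] start(2) show ?thesis by simp
  qed (simp add: start)
qed

section \<open>The energy of a shift\<close>

text \<open>Stated for two arbitrary points and an arbitrary angle \<open>\<kappa>\<close>, so that
  one constant serves both pieces of the shift. On the right, the terms up to the factor
  \<open>\<mu>\<close> form the derivative of the later \<open>flux_term\<close>, the terms with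
  cosine and sine differences integrate to zero in total, and the last term is the energy density up
  to a factor.\<close>

lemma energy_density_estimate:
  assumes "0 \<le> T"
  obtains C where "\<And>t s s' \<kappa>. 0 < t \<Longrightarrow> t \<le> T \<Longrightarrow> s \<in> {0..L} \<Longrightarrow> s' \<in> {0..L} \<Longrightarrow>
    (\<theta> t s' + \<kappa> - \<theta> t s) * (dt \<theta> t s' - dt \<theta> t s) + (\<rho> t s' - \<rho> t s) * (dt \<rho> t s' - dt \<rho> t s)
    \<le> (\<theta> t s' + \<kappa> - \<theta> t s) * (ds L (flux t) s' - ds L (flux t) s)
      + (\<theta>\<^sub>s t s' - \<theta>\<^sub>s t s) * (flux t s' - flux t s)
      + \<mu> * ((\<rho> t s' - \<rho> t s) * ((ds L ^^ 2) (\<rho> t) s' - (ds L ^^ 2) (\<rho> t) s)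
        + (\<rho>\<^sub>s t s' - \<rho>\<^sub>s t s)\<^sup>2)
      - (l1 t * cos \<kappa> - l2 t * sin \<kappa> - l1 t) * (cos (\<theta> t s' + \<kappa>) - cos (\<theta> t s))
      - (l1 t * sin \<kappa> + l2 t * cos \<kappa> - l2 t) * (sin (\<theta> t s' + \<kappa>) - sin (\<theta> t s))
      + C * ((\<theta> t s' + \<kappa> - \<theta> t s)\<^sup>2 + (\<rho> t s' - \<rho> t s)\<^sup>2)"
proof -
  have comp: "compact ({0..T} \<times> {0..L})"
    by (intro compact_Times compact_Icc)
  have sub: "{0..T} \<times> {0..L} \<subseteq> {0..} \<times> {0..L}" by auto
  have "continuous_on ({0..T} \<times> {0..L}) (\<lambda>x. \<theta>\<^sub>s (fst x) (snd x) - c\<^sub>0)"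
    by (intro continuous_intros continuous_on_subset[OF continuous_on_strip(3) sub])
  then obtain U where U: "\<And>x. x \<in> {0..T} \<times> {0..L} \<Longrightarrow> \<bar>\<theta>\<^sub>s (fst x) (snd x) - c\<^sub>0\<bar> \<le> U"
    using continuous_on_compact_bound[OF comp] by blast
  obtain R where R: "\<And>x. x \<in> {0..T} \<times> {0..L} \<Longrightarrow> \<bar>\<rho> (fst x) (snd x)\<bar> \<le> R"
    using continuous_on_compact_bound[OF comp continuous_on_subset[OF continuous_on_strip(2) sub]]
    by blast
  obtain M1 where M1: "0 \<le> M1" "\<And>t. t \<in> {0..T} \<Longrightarrow> \<bar>l1 t\<bar> \<le> M1"
    using continuous_on_compact_bound[OF compact_Icc
        continuous_on_subset[OF continuous_on_multipliers(1), of "{0..T}"]] by auto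
  obtain M2 where M2: "0 \<le> M2" "\<And>t. t \<in> {0..T} \<Longrightarrow> \<bar>l2 t\<bar> \<le> M2"
    using continuous_on_compact_bound[OF compact_Icc
        continuous_on_subset[OF continuous_on_multipliers(2), of "{0..T}"]] by auto
  obtain \<delta> where \<delta>: "0 < \<delta>" "\<And>x. x \<in> {-R..R} \<Longrightarrow> \<delta> \<le> \<bar>\<beta> x\<bar>"
    using continuous_on_compact_away_from_zero[OF compact_Icc smooth_real_continuous_on[OF beta_smooth]]
      beta_pos by (metis less_irrefl)
  obtain K1 where K1: "0 \<le> K1"
    "\<And>x y. x \<in> {-R..R} \<Longrightarrow> y \<in> {-R..R} \<Longrightarrow> \<bar>\<beta> x - \<beta> y\<bar> \<le> K1 * \<bar>x - y\<bar>"
    using smooth_real_Lipschitz[OF beta_smooth] by blast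
  obtain K2 where K2: "0 \<le> K2"
    "\<And>x y. x \<in> {-R..R} \<Longrightarrow> y \<in> {-R..R} \<Longrightarrow> \<bar>deriv \<beta> x - deriv \<beta> y\<bar> \<le> K2 * \<bar>x - y\<bar>"
    using smooth_real_Lipschitz[OF smooth_real_deriv[OF beta_smooth]] by blast
  obtain K3 where K3: "0 \<le> K3" "\<And>x. x \<in> {-R..R} \<Longrightarrow> \<bar>deriv \<beta> x\<bar> \<le> K3"
    using continuous_on_compact_bound[OF compact_Icc
        smooth_real_continuous_on[OF smooth_real_deriv[OF beta_smooth]]] by blast
  define K where "K = K1 + K2 + K3"
  define M where "M = M1 + M2"
  define C1 where "C1 = (K * U)\<^sup>2 / \<delta> + K * U\<^sup>2"
  have K: "0 \<le> K" "K1 \<le> K" "K2 \<le> K" "K3 \<le> K"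
    using K1(1) K2(1) K3(1) by (auto simp: K_def)
  show thesis
  proof (rule that)
    fix t s s' \<kappa> assume t: "0 < t" "t \<le> T" and s: "s \<in> {0..L}" "s' \<in> {0..L}"
    define w where "w = \<theta> t s' + \<kappa> - \<theta> t s"
    define r where "r = \<rho> t s' - \<rho> t s"
    \<comment> \<open>The vector (\<open>m1\<close>, \<open>m2\<close>) is the multiplier vector
      rotated by \<open>\<kappa>\<close>: rotating the angle and the multipliers together leaves the
      multiplier term unchanged.\<close>
    define m1 where "m1 = l1 t * cos \<kappa> - l2 t * sin \<kappa>"
    define m2 where "m2 = l1 t * sin \<kappa> + l2 t * cos \<kappa>"
    have R': "\<rho> t s \<in> {-R..R}" "\<rho> t s' \<in> {-R..R}"
      using R[of "(t, s)"] R[of "(t, s')"] t s by auto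
    have U': "\<bar>\<theta>\<^sub>s t s - c\<^sub>0\<bar> \<le> U" "\<bar>\<theta>\<^sub>s t s' - c\<^sub>0\<bar> \<le> U"
      using U[of "(t, s)"] U[of "(t, s')"] t s by auto
    have prod: "\<bar>a * x\<bar> \<le> B" if "\<bar>a\<bar> \<le> B" "\<bar>x\<bar> \<le> 1" for a x B :: real
      using mult_mono[OF that] that by (simp add: abs_mult)
    have l: "\<bar>l1 t\<bar> \<le> M1" "\<bar>l2 t\<bar> \<le> M2"
      using M1(2) M2(2) t by auto
    have M: "\<bar>l1 t\<bar> \<le> M" "\<bar>l2 t\<bar> \<le> M" "\<bar>m1\<bar> \<le> M" "\<bar>m2\<bar> \<le> M"
      using l M1(1) M2(1) prod[OF l(1), of "cos \<kappa>"] prod[OF l(1), of "sin \<kappa>"]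
        prod[OF l(2), of "cos \<kappa>"] prod[OF l(2), of "sin \<kappa>"]
      unfolding M_def m1_def m2_def by auto
    have rot: "l1 t * sin (\<theta> t s') - l2 t * cos (\<theta> t s')
        = m1 * sin (\<theta> t s' + \<kappa>) - m2 * cos (\<theta> t s' + \<kappa>)"
    proof -
      have "m1 * sin (\<theta> t s' + \<kappa>) - m2 * cos (\<theta> t s' + \<kappa>)
        = (l1 t * sin (\<theta> t s') - l2 t * cos (\<theta> t s')) * ((sin \<kappa>)\<^sup>2 + (cos \<kappa>)\<^sup>2)"
        unfolding m1_def m2_def sin_add cos_add by algebra
      then show ?thesis by simp
    qed
    have 1: "w * ((m1 * sin (\<theta> t s' + \<kappa>) - m2 * cos (\<theta> t s' + \<kappa>)) - (l1 t * sin (\<theta> t s) - l2 t * cos (\<theta> t s)))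
      \<le> - (m1 - l1 t) * (cos (\<theta> t s' + \<kappa>) - cos (\<theta> t s))
        - (m2 - l2 t) * (sin (\<theta> t s' + \<kappa>) - sin (\<theta> t s)) + 6 * M * w\<^sup>2"
      unfolding w_def by (rule multiplier_difference_bound[OF M])
    have mono: "k * \<bar>r\<bar> \<le> K * \<bar>r\<bar>" if "k \<le> K" for k
      using that by (intro mult_right_mono) auto
    have 2: "- ((\<theta>\<^sub>s t s' - c\<^sub>0) - (\<theta>\<^sub>s t s - c\<^sub>0)) * (\<beta> (\<rho> t s') * (\<theta>\<^sub>s t s' - c\<^sub>0) - \<beta> (\<rho> t s) * (\<theta>\<^sub>s t s - c\<^sub>0))
        - 1 / 2 * r * (deriv \<beta> (\<rho> t s') * (\<theta>\<^sub>s t s' - c\<^sub>0)\<^sup>2 - deriv \<beta> (\<rho> t s) * (\<theta>\<^sub>s t s - c\<^sub>0)\<^sup>2) \<le> C1 * r\<^sup>2"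
      unfolding C1_def
    proof (rule parabolic_difference_bound[OF \<delta>(1) _ _ _ _ U' K(1)])
      show "\<delta> \<le> \<beta> (\<rho> t s')"
        using \<delta>(2)[OF R'(2)] beta_pos[of "\<rho> t s'"] by simp
      show "\<bar>\<beta> (\<rho> t s') - \<beta> (\<rho> t s)\<bar> \<le> K * \<bar>r\<bar>"
        using K1(2)[OF R'(2,1)] mono[OF K(2)] unfolding r_def by linarith
      show "\<bar>deriv \<beta> (\<rho> t s') - deriv \<beta> (\<rho> t s)\<bar> \<le> K * \<bar>r\<bar>"
        using K2(2)[OF R'(2,1)] mono[OF K(3)] unfolding r_def by linarith
      show "\<bar>deriv \<beta> (\<rho> t s)\<bar> \<le> K"
        using K3(2)[OF R'(1)] K(4) by linarith
    qed
    \<comment> \<open>Adding this square on the right completes the diffusion term of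
      \<open>\<rho>\<close> to an exact derivative.\<close>
    have 3: "0 \<le> \<mu> * (\<rho>\<^sub>s t s' - \<rho>\<^sub>s t s)\<^sup>2"
      using mu_pos by simp
    have 4: "6 * M * w\<^sup>2 + C1 * r\<^sup>2 \<le> (6 * M + \<bar>C1\<bar>) * (w\<^sup>2 + r\<^sup>2)"
    proof -
      have "C1 * r\<^sup>2 \<le> \<bar>C1\<bar> * r\<^sup>2" "0 \<le> \<bar>C1\<bar> * w\<^sup>2" "0 \<le> 6 * M * r\<^sup>2"
        using M1(1) M2(1) by (auto simp: M_def intro: mult_right_mono)
      then show ?thesis unfolding distrib_left distrib_right by linarith
    qed
    have \<theta>_diff: "dt \<theta> t s' - dt \<theta> t s = ds L (flux t) s' - ds L (flux t) s
        + ((m1 * sin (\<theta> t s' + \<kappa>) - m2 * cos (\<theta> t s' + \<kappa>)) - (l1 t * sin (\<theta> t s) - l2 t * cos (\<theta> t s)))"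
      using theta_equation[OF t(1) s(1)] theta_equation[OF t(1) s(2)] rot by linarith
    \<comment> \<open>Both points are taken at the same time, so \<open>lambda_rho\<close>
      cancels.\<close>
    have \<rho>_diff: "dt \<rho> t s' - dt \<rho> t s = \<mu> * ((ds L ^^ 2) (\<rho> t) s' - (ds L ^^ 2) (\<rho> t) s)
        - 1 / 2 * (deriv \<beta> (\<rho> t s') * (\<theta>\<^sub>s t s' - c\<^sub>0)\<^sup>2 - deriv \<beta> (\<rho> t s) * (\<theta>\<^sub>s t s - c\<^sub>0)\<^sup>2)"
      unfolding rho_equation[OF t(1) s(1)] rho_equation[OF t(1) s(2)] by (simp add: algebra_simps)
    \<comment> \<open>The product of the differences of \<open>\<theta>\<^sub>s\<close> and of the
      flux is added and subtracted: once it completes the exact derivative, once it enters the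
      parabolic estimate.\<close>
    have "w * (dt \<theta> t s' - dt \<theta> t s) + r * (dt \<rho> t s' - dt \<rho> t s)
      = w * (ds L (flux t) s' - ds L (flux t) s) + (\<theta>\<^sub>s t s' - \<theta>\<^sub>s t s) * (flux t s' - flux t s)
        + \<mu> * (r * ((ds L ^^ 2) (\<rho> t) s' - (ds L ^^ 2) (\<rho> t) s))
        + w * ((m1 * sin (\<theta> t s' + \<kappa>) - m2 * cos (\<theta> t s' + \<kappa>)) - (l1 t * sin (\<theta> t s) - l2 t * cos (\<theta> t s)))
        + (- ((\<theta>\<^sub>s t s' - c\<^sub>0) - (\<theta>\<^sub>s t s - c\<^sub>0)) * (\<beta> (\<rho> t s') * (\<theta>\<^sub>s t s' - c\<^sub>0) - \<beta> (\<rho> t s) * (\<theta>\<^sub>s t s - c\<^sub>0))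
        - 1 / 2 * r * (deriv \<beta> (\<rho> t s') * (\<theta>\<^sub>s t s' - c\<^sub>0)\<^sup>2 - deriv \<beta> (\<rho> t s) * (\<theta>\<^sub>s t s - c\<^sub>0)\<^sup>2))"
      unfolding \<theta>_diff \<rho>_diff flux_def by (simp add: algebra_simps)
    also have "\<dots> \<le> w * (ds L (flux t) s' - ds L (flux t) s) + (\<theta>\<^sub>s t s' - \<theta>\<^sub>s t s) * (flux t s' - flux t s)
        + \<mu> * (r * ((ds L ^^ 2) (\<rho> t) s' - (ds L ^^ 2) (\<rho> t) s) + (\<rho>\<^sub>s t s' - \<rho>\<^sub>s t s)\<^sup>2)
        - (m1 - l1 t) * (cos (\<theta> t s' + \<kappa>) - cos (\<theta> t s))
        - (m2 - l2 t) * (sin (\<theta> t s' + \<kappa>) - sin (\<theta> t s)) + (6 * M + \<bar>C1\<bar>) * (w\<^sup>2 + r\<^sup>2)"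
      using 1 2 3 4 unfolding distrib_left[of \<mu>] by linarith
    finally show "(\<theta> t s' + \<kappa> - \<theta> t s) * (dt \<theta> t s' - dt \<theta> t s) + (\<rho> t s' - \<rho> t s) * (dt \<rho> t s' - dt \<rho> t s)
      \<le> (\<theta> t s' + \<kappa> - \<theta> t s) * (ds L (flux t) s' - ds L (flux t) s)
      + (\<theta>\<^sub>s t s' - \<theta>\<^sub>s t s) * (flux t s' - flux t s)
      + \<mu> * ((\<rho> t s' - \<rho> t s) * ((ds L ^^ 2) (\<rho> t) s' - (ds L ^^ 2) (\<rho> t) s)
        + (\<rho>\<^sub>s t s' - \<rho>\<^sub>s t s)\<^sup>2)
      - (l1 t * cos \<kappa> - l2 t * sin \<kappa> - l1 t) * (cos (\<theta> t s' + \<kappa>) - cos (\<theta> t s))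
      - (l1 t * sin \<kappa> + l2 t * cos \<kappa> - l2 t) * (sin (\<theta> t s' + \<kappa>) - sin (\<theta> t s))
      + (6 * M + \<bar>C1\<bar>) * ((\<theta> t s' + \<kappa> - \<theta> t s)\<^sup>2 + (\<rho> t s' - \<rho> t s)\<^sup>2)"
      unfolding w_def r_def m1_def m2_def .
  qed
qed

text \<open>The derivative of \<open>flux_term\<close> in \<open>s\<close> collects the terms of the energy rate that integrate by parts.\<close>

definition energy :: "real \<Rightarrow> real \<Rightarrow> real \<Rightarrow> real \<Rightarrow> real \<Rightarrow> real" where
  "energy a b d \<kappa> t = integral {a..b} (\<lambda>s. ((\<theta> t (s + d) + \<kappa> - \<theta> t s)\<^sup>2 + (\<rho> t (s + d) - \<rho> t s)\<^sup>2) / 2)"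

definition flux_term :: "real \<Rightarrow> real \<Rightarrow> real \<Rightarrow> real \<Rightarrow> real" where
  "flux_term d \<kappa> t s = (\<theta> t (s + d) + \<kappa> - \<theta> t s) * (flux t (s + d) - flux t s)
    + \<mu> * ((\<rho> t (s + d) - \<rho> t s) * (\<rho>\<^sub>s t (s + d) - \<rho>\<^sub>s t s))"

text \<open>Together the two defects are the difference of the displacement vectors along
  \<open>{a..b}\<close> of the shifted, rotated curve and of the original one.\<close>

definition "cos_defect a b d \<kappa> t = integral {a..b} (\<lambda>s. cos (\<theta> t (s + d) + \<kappa>) - cos (\<theta> t s))"
definition "sin_defect a b d \<kappa> t = integral {a..b} (\<lambda>s. sin (\<theta> t (s + d) + \<kappa>) - sin (\<theta> t s))"

section \<open>Continuity and time derivative of the energy on one piece\<close>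

lemma continuous_on_pieces:
  assumes "0 \<le> a" "b \<le> L" "0 \<le> a + d" "b + d \<le> L"
  shows "continuous_on ({0..} \<times> {a..b}) (\<lambda>x. \<theta> (fst x) (snd x + d))"
    "continuous_on ({0..} \<times> {a..b}) (\<lambda>x. \<rho> (fst x) (snd x + d))"
    "continuous_on ({0..} \<times> {a..b}) (\<lambda>x. \<theta> (fst x) (snd x))"
    "continuous_on ({0..} \<times> {a..b}) (\<lambda>x. \<rho> (fst x) (snd x))"
    "continuous_on ({0<..} \<times> {a..b}) (\<lambda>x. \<theta> (fst x) (snd x + d))"
    "continuous_on ({0<..} \<times> {a..b}) (\<lambda>x. \<rho> (fst x) (snd x + d))"
    "continuous_on ({0<..} \<times> {a..b}) (\<lambda>x. \<theta> (fst x) (snd x))"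
    "continuous_on ({0<..} \<times> {a..b}) (\<lambda>x. \<rho> (fst x) (snd x))"
    "continuous_on ({0<..} \<times> {a..b}) (\<lambda>x. dt \<theta> (fst x) (snd x + d))"
    "continuous_on ({0<..} \<times> {a..b}) (\<lambda>x. dt \<rho> (fst x) (snd x + d))"
    "continuous_on ({0<..} \<times> {a..b}) (\<lambda>x. dt \<theta> (fst x) (snd x))"
    "continuous_on ({0<..} \<times> {a..b}) (\<lambda>x. dt \<rho> (fst x) (snd x))"
proof -
  have "s + d \<in> {0..L}" "s + 0 \<in> {0..L}" if "s \<in> {a..b}" for s
    using that assms by auto
  note shift = continuous_on_strip_shift[OF _ _ this(1)]
    continuous_on_strip_shift[OF _ _ this(2), unfolded add_0_right]
  have sub: "{0..} \<subseteq> {0::real..}" "{0<..} \<subseteq> {0::real..}" "{0<..} \<subseteq> {0::real<..}"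
    by auto
  show "continuous_on ({0..} \<times> {a..b}) (\<lambda>x. \<theta> (fst x) (snd x + d))"
    "continuous_on ({0<..} \<times> {a..b}) (\<lambda>x. \<theta> (fst x) (snd x + d))"
    by (rule shift(1)[OF continuous_on_strip(1)], simp_all add: sub)+
  show "continuous_on ({0..} \<times> {a..b}) (\<lambda>x. \<rho> (fst x) (snd x + d))"
    "continuous_on ({0<..} \<times> {a..b}) (\<lambda>x. \<rho> (fst x) (snd x + d))"
    by (rule shift(1)[OF continuous_on_strip(2)], simp_all add: sub)+
  show "continuous_on ({0..} \<times> {a..b}) (\<lambda>x. \<theta> (fst x) (snd x))"
    "continuous_on ({0<..} \<times> {a..b}) (\<lambda>x. \<theta> (fst x) (snd x))"
    by (rule shift(2)[OF continuous_on_strip(1)], simp_all add: sub)+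
  show "continuous_on ({0..} \<times> {a..b}) (\<lambda>x. \<rho> (fst x) (snd x))"
    "continuous_on ({0<..} \<times> {a..b}) (\<lambda>x. \<rho> (fst x) (snd x))"
    by (rule shift(2)[OF continuous_on_strip(2)], simp_all add: sub)+
  show "continuous_on ({0<..} \<times> {a..b}) (\<lambda>x. dt \<theta> (fst x) (snd x + d))"
    by (rule shift(1)[OF continuous_on_dt(1) sub(3)])
  show "continuous_on ({0<..} \<times> {a..b}) (\<lambda>x. dt \<rho> (fst x) (snd x + d))"
    by (rule shift(1)[OF continuous_on_dt(2) sub(3)])
  show "continuous_on ({0<..} \<times> {a..b}) (\<lambda>x. dt \<theta> (fst x) (snd x))"
    by (rule shift(2)[OF continuous_on_dt(1) sub(3)])
  show "continuous_on ({0<..} \<times> {a..b}) (\<lambda>x. dt \<rho> (fst x) (snd x))"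
    by (rule shift(2)[OF continuous_on_dt(2) sub(3)])
qed

lemma continuous_on_piece_slices:
  assumes "0 \<le> a" "b \<le> L" "0 \<le> a + d" "b + d \<le> L" "0 \<le> t"
  shows "continuous_on {a..b} (\<lambda>s. \<theta> t (s + d))" "continuous_on {a..b} (\<lambda>s. \<rho> t (s + d))"
    "continuous_on {a..b} (\<theta> t)" "continuous_on {a..b} (\<rho> t)"
proof -
  have "continuous_on {a..b} (Pair t)" "Pair t ` {a..b} \<subseteq> {0..} \<times> {a..b}"
    using assms by (auto intro!: continuous_intros)
  from continuous_on_pieces(1-4)[OF assms(1-4), THEN continuous_on_compose2, OF this]
  show "continuous_on {a..b} (\<lambda>s. \<theta> t (s + d))" "continuous_on {a..b} (\<lambda>s. \<rho> t (s + d))"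
    "continuous_on {a..b} (\<theta> t)" "continuous_on {a..b} (\<rho> t)"
    by simp_all
qed

lemma continuous_on_piece_slices_dt:
  assumes "0 \<le> a" "b \<le> L" "0 \<le> a + d" "b + d \<le> L" "0 < t"
  shows "continuous_on {a..b} (\<lambda>s. dt \<theta> t (s + d))" "continuous_on {a..b} (\<lambda>s. dt \<rho> t (s + d))"
    "continuous_on {a..b} (dt \<theta> t)" "continuous_on {a..b} (dt \<rho> t)"
proof -
  have "continuous_on {a..b} (Pair t)" "Pair t ` {a..b} \<subseteq> {0<..} \<times> {a..b}"
    using assms by (auto intro!: continuous_intros)
  from continuous_on_pieces(9-12)[OF assms(1-4), THEN continuous_on_compose2, OF this]
  show "continuous_on {a..b} (\<lambda>s. dt \<theta> t (s + d))" "continuous_on {a..b} (\<lambda>s. dt \<rho> t (s + d))"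
    "continuous_on {a..b} (dt \<theta> t)" "continuous_on {a..b} (dt \<rho> t)"
    by simp_all
qed

lemma continuous_on_energy:
  assumes "0 \<le> a" "b \<le> L" "0 \<le> a + d" "b + d \<le> L"
  shows "continuous_on {0..} (energy a b d \<kappa>)"
  unfolding energy_def
  by (intro continuous_on_integral_strip continuous_intros continuous_on_pieces[OF assms]) simp_all

lemma energy_nonneg: "0 \<le> energy a b d \<kappa> t"
\<comment> \<open>\<open>integral\<close> is 0 by default on functions that are not integrable, so
  nonnegativity holds for all parameters.\<close>
proof (cases "(\<lambda>s. ((\<theta> t (s + d) + \<kappa> - \<theta> t s)\<^sup>2 + (\<rho> t (s + d) - \<rho> t s)\<^sup>2) / 2) integrable_on {a..b}")
  case True
  then show ?thesis unfolding energy_def by (rule integral_nonneg) simp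
qed (simp add: energy_def not_integrable_integral)

lemma energy_zero_imp:
  assumes "a < b" "0 \<le> a" "b \<le> L" "0 \<le> a + d" "b + d \<le> L" "0 \<le> t"
    and "energy a b d \<kappa> t = 0" "s \<in> {a..b}"
  shows "\<theta> t (s + d) + \<kappa> = \<theta> t s" "\<rho> t (s + d) = \<rho> t s"
proof -
  have "continuous_on {a..b} (\<lambda>s. ((\<theta> t (s + d) + \<kappa> - \<theta> t s)\<^sup>2 + (\<rho> t (s + d) - \<rho> t s)\<^sup>2) / 2)"
    by (intro continuous_intros continuous_on_piece_slices[OF assms(2-6)]) simp_all
  from integral_eq_0_iff[OF this \<open>a < b\<close>] assms(7,8)
  have "(\<theta> t (s + d) + \<kappa> - \<theta> t s)\<^sup>2 + (\<rho> t (s + d) - \<rho> t s)\<^sup>2 = 0"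
    by (simp add: energy_def)
  then show "\<theta> t (s + d) + \<kappa> = \<theta> t s" "\<rho> t (s + d) = \<rho> t s"
    by (simp_all add: sum_power2_eq_zero_iff)
qed

lemma energy_has_derivative:
  assumes "0 \<le> a" "b \<le> L" "0 \<le> a + d" "b + d \<le> L" "0 < t"
  shows "(energy a b d \<kappa> has_real_derivative integral {a..b} (\<lambda>s.
      (\<theta> t (s + d) + \<kappa> - \<theta> t s) * (dt \<theta> t (s + d) - dt \<theta> t s)
      + (\<rho> t (s + d) - \<rho> t s) * (dt \<rho> t (s + d) - dt \<rho> t s))) (at t)"
  unfolding energy_def
proof (rule integral_strip_has_derivative)
  fix \<tau> s :: real assume "0 < \<tau>" "s \<in> {a..b}"
  then have "s \<in> {0..L}" "s + d \<in> {0..L}" using assms by auto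
  note der = has_time_derivative[OF \<open>0 < \<tau>\<close> this(1)] has_time_derivative[OF \<open>0 < \<tau>\<close> this(2)]
  show "((\<lambda>\<tau>. ((\<theta> \<tau> (s + d) + \<kappa> - \<theta> \<tau> s)\<^sup>2 + (\<rho> \<tau> (s + d) - \<rho> \<tau> s)\<^sup>2) / 2) has_real_derivative
      (\<theta> \<tau> (s + d) + \<kappa> - \<theta> \<tau> s) * (dt \<theta> \<tau> (s + d) - dt \<theta> \<tau> s)
      + (\<rho> \<tau> (s + d) - \<rho> \<tau> s) * (dt \<rho> \<tau> (s + d) - dt \<rho> \<tau> s)) (at \<tau>)"
    by (rule derivative_eq_intros der refl | simp)+
next
  fix \<tau> :: real assume "0 < \<tau>"
  from continuous_on_piece_slices[OF assms(1-4) less_imp_le[OF this]]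
  show "continuous_on {a..b} (\<lambda>s. ((\<theta> \<tau> (s + d) + \<kappa> - \<theta> \<tau> s)\<^sup>2 + (\<rho> \<tau> (s + d) - \<rho> \<tau> s)\<^sup>2) / 2)"
    by (intro continuous_intros) simp_all
next
  show "continuous_on ({0<..} \<times> {a..b}) (\<lambda>x.
      (\<theta> (fst x) (snd x + d) + \<kappa> - \<theta> (fst x) (snd x)) * (dt \<theta> (fst x) (snd x + d) - dt \<theta> (fst x) (snd x))
      + (\<rho> (fst x) (snd x + d) - \<rho> (fst x) (snd x)) * (dt \<rho> (fst x) (snd x + d) - dt \<rho> (fst x) (snd x)))"
    by (intro continuous_intros continuous_on_pieces[OF assms(1-4)])
qed fact

lemma flux_term_has_derivative:
  assumes "0 \<le> a" "b \<le> L" "0 \<le> a + d" "b + d \<le> L" "0 < t" "s \<in> {a..b}"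
  shows "(flux_term d \<kappa> t has_real_derivative
      (\<theta> t (s + d) + \<kappa> - \<theta> t s) * (ds L (flux t) (s + d) - ds L (flux t) s)
      + (\<theta>\<^sub>s t (s + d) - \<theta>\<^sub>s t s) * (flux t (s + d) - flux t s)
      + \<mu> * ((\<rho> t (s + d) - \<rho> t s) * ((ds L ^^ 2) (\<rho> t) (s + d) - (ds L ^^ 2) (\<rho> t) s)
        + (\<rho>\<^sub>s t (s + d) - \<rho>\<^sub>s t s)\<^sup>2)) (at s within {a..b})"
proof -
  have s: "s \<in> {0..L}" "s + d \<in> {0..L}" and im: "(\<lambda>s. s + d) ` {a..b} \<subseteq> {0..L}" "{a..b} \<subseteq> {0..L}"
    using assms by auto
  note der = has_space_derivative[OF assms(5) s(1), THEN DERIV_subset, OF im(2)]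
    has_space_derivative[OF assms(5) s(2), THEN has_real_derivative_shift, OF im(1)]
  show ?thesis
    unfolding flux_term_def
    by (rule derivative_eq_intros der refl | simp add: algebra_simps power2_eq_square)+
qed

text \<open>The pointwise estimate is integrated; the exact derivative turns into boundary values of
  \<open>flux_term\<close>. The constant is chosen before the piece, the shift and the
  angle.\<close>

lemma energy_rate:
  assumes "0 \<le> T"
  obtains C where "\<And>t a b d \<kappa>. 0 < t \<Longrightarrow> t \<le> T \<Longrightarrow> a \<le> b \<Longrightarrow> 0 \<le> a \<Longrightarrow> b \<le> L \<Longrightarrow>
    0 \<le> a + d \<Longrightarrow> b + d \<le> L \<Longrightarrow>
    \<exists>D. (energy a b d \<kappa> has_real_derivative D) (at t) \<and>
      D \<le> flux_term d \<kappa> t b - flux_term d \<kappa> t a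
        - (l1 t * cos \<kappa> - l2 t * sin \<kappa> - l1 t) * cos_defect a b d \<kappa> t
        - (l1 t * sin \<kappa> + l2 t * cos \<kappa> - l2 t) * sin_defect a b d \<kappa> t
        + C * energy a b d \<kappa> t"
proof -
  obtain C where C: "\<And>t s s' \<kappa>. 0 < t \<Longrightarrow> t \<le> T \<Longrightarrow> s \<in> {0..L} \<Longrightarrow> s' \<in> {0..L} \<Longrightarrow>
    (\<theta> t s' + \<kappa> - \<theta> t s) * (dt \<theta> t s' - dt \<theta> t s) + (\<rho> t s' - \<rho> t s) * (dt \<rho> t s' - dt \<rho> t s)
    \<le> (\<theta> t s' + \<kappa> - \<theta> t s) * (ds L (flux t) s' - ds L (flux t) s)
      + (\<theta>\<^sub>s t s' - \<theta>\<^sub>s t s) * (flux t s' - flux t s)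
      + \<mu> * ((\<rho> t s' - \<rho> t s) * ((ds L ^^ 2) (\<rho> t) s' - (ds L ^^ 2) (\<rho> t) s)
        + (\<rho>\<^sub>s t s' - \<rho>\<^sub>s t s)\<^sup>2)
      - (l1 t * cos \<kappa> - l2 t * sin \<kappa> - l1 t) * (cos (\<theta> t s' + \<kappa>) - cos (\<theta> t s))
      - (l1 t * sin \<kappa> + l2 t * cos \<kappa> - l2 t) * (sin (\<theta> t s' + \<kappa>) - sin (\<theta> t s))
      + C * ((\<theta> t s' + \<kappa> - \<theta> t s)\<^sup>2 + (\<rho> t s' - \<rho> t s)\<^sup>2)"
    using energy_density_estimate[OF assms] by blast
  show thesis
  proof (rule that)
    fix t a b d \<kappa> :: real
    assume t: "0 < t" "t \<le> T" and "a \<le> b" and ab: "0 \<le> a" "b \<le> L" "0 \<le> a + d" "b + d \<le> L"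
    note cont = continuous_on_piece_slices[OF ab less_imp_le[OF t(1)]]
      continuous_on_piece_slices_dt[OF ab t(1)]
    define m1 where "m1 = l1 t * cos \<kappa> - l2 t * sin \<kappa> - l1 t"
    define m2 where "m2 = l1 t * sin \<kappa> + l2 t * cos \<kappa> - l2 t"
    define rate where "rate s = (\<theta> t (s + d) + \<kappa> - \<theta> t s) * (dt \<theta> t (s + d) - dt \<theta> t s)
      + (\<rho> t (s + d) - \<rho> t s) * (dt \<rho> t (s + d) - dt \<rho> t s)" for s
    define dv where "dv s = (\<theta> t (s + d) + \<kappa> - \<theta> t s) * (ds L (flux t) (s + d) - ds L (flux t) s)
      + (\<theta>\<^sub>s t (s + d) - \<theta>\<^sub>s t s) * (flux t (s + d) - flux t s)
      + \<mu> * ((\<rho> t (s + d) - \<rho> t s) * ((ds L ^^ 2) (\<rho> t) (s + d) - (ds L ^^ 2) (\<rho> t) s)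
        + (\<rho>\<^sub>s t (s + d) - \<rho>\<^sub>s t s)\<^sup>2)" for s
    have rate: "(rate has_integral integral {a..b} rate) {a..b}"
      unfolding rate_def
      by (intro integrable_integral integrable_continuous_real continuous_intros cont)
    have dv: "(dv has_integral flux_term d \<kappa> t b - flux_term d \<kappa> t a) {a..b}"
      using flux_term_has_derivative[OF ab t(1)]
      by (intro fundamental_theorem_of_calculus \<open>a \<le> b\<close>)
        (simp add: dv_def flip: has_real_derivative_iff_has_vector_derivative)
    have cos: "((\<lambda>s. cos (\<theta> t (s + d) + \<kappa>) - cos (\<theta> t s)) has_integral cos_defect a b d \<kappa> t) {a..b}"
      unfolding cos_defect_def
      by (intro integrable_integral integrable_continuous_real continuous_intros cont)
    have sin: "((\<lambda>s. sin (\<theta> t (s + d) + \<kappa>) - sin (\<theta> t s)) has_integral sin_defect a b d \<kappa> t) {a..b}"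
      unfolding sin_defect_def
      by (intro integrable_integral integrable_continuous_real continuous_intros cont)
    have energy: "((\<lambda>s. ((\<theta> t (s + d) + \<kappa> - \<theta> t s)\<^sup>2 + (\<rho> t (s + d) - \<rho> t s)\<^sup>2) / 2)
        has_integral energy a b d \<kappa> t) {a..b}"
      unfolding energy_def
      by (intro integrable_integral integrable_continuous_real continuous_intros cont) simp_all
    \<comment> \<open>The factor 2 compensates for the 1/2 in the energy.\<close>
    have "integral {a..b} rate \<le> flux_term d \<kappa> t b - flux_term d \<kappa> t a
        - m1 * cos_defect a b d \<kappa> t - m2 * sin_defect a b d \<kappa> t + 2 * C * energy a b d \<kappa> t"
    proof (rule has_integral_le[OF rate])
      show "((\<lambda>s. dv s - m1 * (cos (\<theta> t (s + d) + \<kappa>) - cos (\<theta> t s))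
          - m2 * (sin (\<theta> t (s + d) + \<kappa>) - sin (\<theta> t s))
          + 2 * C * (((\<theta> t (s + d) + \<kappa> - \<theta> t s)\<^sup>2 + (\<rho> t (s + d) - \<rho> t s)\<^sup>2) / 2)) has_integral
        flux_term d \<kappa> t b - flux_term d \<kappa> t a
        - m1 * cos_defect a b d \<kappa> t - m2 * sin_defect a b d \<kappa> t + 2 * C * energy a b d \<kappa> t) {a..b}"
        by (intro has_integral_add[OF has_integral_diff[OF has_integral_diff[OF dv]]]
            has_integral_mult_right cos sin energy)
    next
      fix s assume "s \<in> {a..b}"
      then have "s \<in> {0..L}" "s + d \<in> {0..L}" using ab by auto
      from C[OF t this, of \<kappa>]
      show "rate s \<le> dv s - m1 * (cos (\<theta> t (s + d) + \<kappa>) - cos (\<theta> t s))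
          - m2 * (sin (\<theta> t (s + d) + \<kappa>) - sin (\<theta> t s))
          + 2 * C * (((\<theta> t (s + d) + \<kappa> - \<theta> t s)\<^sup>2 + (\<rho> t (s + d) - \<rho> t s)\<^sup>2) / 2)"
        unfolding rate_def dv_def m1_def m2_def by simp
    qed
    moreover have "(energy a b d \<kappa> has_real_derivative integral {a..b} rate) (at t)"
      unfolding rate_def by (rule energy_has_derivative[OF ab t(1)])
    ultimately show "\<exists>D. (energy a b d \<kappa> has_real_derivative D) (at t) \<and>
      D \<le> flux_term d \<kappa> t b - flux_term d \<kappa> t a
        - (l1 t * cos \<kappa> - l2 t * sin \<kappa> - l1 t) * cos_defect a b d \<kappa> t
        - (l1 t * sin \<kappa> + l2 t * cos \<kappa> - l2 t) * sin_defect a b d \<kappa> t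
        + 2 * C * energy a b d \<kappa> t"
      unfolding m1_def m2_def by blast
  qed
qed

section \<open>Cancellation between the two pieces\<close>

lemma cos_sin_add_rotation:
  "cos (x + (\<kappa> + 2 * pi * of_int \<omega>)) = cos (x + \<kappa>)"
  "sin (x + (\<kappa> + 2 * pi * of_int \<omega>)) = sin (x + \<kappa>)"
  unfolding add.assoc[symmetric] cos_add[of "x + \<kappa>" "2 * pi * of_int \<omega>"]
    sin_add[of "x + \<kappa>" "2 * pi * of_int \<omega>"]
  by (simp_all add: cos_int_2pin sin_int_2pin)

text \<open>Over both pieces the shifted argument sweeps out one period, so each sum is a closing
  integral of the rotated curve minus one of the original curve. Both vanish, since rotation by
  \<open>\<kappa>\<close> only mixes the two closing integrals.\<close>

lemma defects_cancel:
  assumes "0 \<le> a" "a \<le> L" "0 \<le> t"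
  shows "cos_defect 0 (L - a) a \<kappa> t + cos_defect (L - a) L (a - L) (\<kappa> + 2 * pi * of_int \<omega>) t = 0"
    "sin_defect 0 (L - a) a \<kappa> t + sin_defect (L - a) L (a - L) (\<kappa> + 2 * pi * of_int \<omega>) t = 0"
proof -
  have "0 \<le> (0::real)" "L - a \<le> L" "0 \<le> 0 + a" "L - a + a \<le> L"
    and "0 \<le> L - a" "L \<le> L" "0 \<le> L - a + (a - L)" "L + (a - L) \<le> L"
    using assms by auto
  note cont = continuous_on_piece_slices[OF this(1-4) assms(3)]
    continuous_on_piece_slices[OF this(5-8) assms(3)] continuous_on_slice(1)[OF assms(3)]
  have "((\<lambda>s. cos (\<theta> t s)) has_integral 0) {0..L}" "((\<lambda>s. sin (\<theta> t s)) has_integral 0) {0..L}"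
    unfolding has_integral_integrable_integral
    by (intro conjI integrable_continuous_real continuous_intros cont closed assms(3))+
  note zero = this[THEN has_integral_mult_left]
  have rotated: "integral {0..L} (\<lambda>s. cos (\<theta> t s + \<kappa>)) = 0" "integral {0..L} (\<lambda>s. sin (\<theta> t s + \<kappa>)) = 0"
    using integral_unique[OF has_integral_diff[OF zero(1)[of "cos \<kappa>"] zero(2)[of "sin \<kappa>"]]]
      integral_unique[OF has_integral_add[OF zero(2)[of "cos \<kappa>"] zero(1)[of "sin \<kappa>"]]]
    by (simp_all add: cos_add sin_add)
  have int: "(\<lambda>s. cos (\<theta> t (s + a) + \<kappa>)) integrable_on {0..L - a}"
    "(\<lambda>s. cos (\<theta> t s)) integrable_on {0..L - a}"
    "(\<lambda>s. cos (\<theta> t (s + (a - L)) + \<kappa>)) integrable_on {L - a..L}"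
    "(\<lambda>s. cos (\<theta> t s)) integrable_on {L - a..L}"
    "(\<lambda>s. cos (\<theta> t s)) integrable_on {0..L}"
    by (intro integrable_continuous_real continuous_intros cont)+
  have "continuous_on {0..L} (\<lambda>s. cos (\<theta> t s + \<kappa>))"
    by (intro continuous_intros cont)
  from integral_cyclic_shift[OF assms(1,2) this]
    Henstock_Kurzweil_Integration.integral_combine[OF \<open>0 \<le> L - a\<close> \<open>L - a \<le> L\<close> int(5)]
  show "cos_defect 0 (L - a) a \<kappa> t + cos_defect (L - a) L (a - L) (\<kappa> + 2 * pi * of_int \<omega>) t = 0"
    unfolding cos_defect_def cos_sin_add_rotation integral_diff[OF int(1,2)] integral_diff[OF int(3,4)]
    using rotated closed[OF assms(3)] by linarith
  have int: "(\<lambda>s. sin (\<theta> t (s + a) + \<kappa>)) integrable_on {0..L - a}"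
    "(\<lambda>s. sin (\<theta> t s)) integrable_on {0..L - a}"
    "(\<lambda>s. sin (\<theta> t (s + (a - L)) + \<kappa>)) integrable_on {L - a..L}"
    "(\<lambda>s. sin (\<theta> t s)) integrable_on {L - a..L}"
    "(\<lambda>s. sin (\<theta> t s)) integrable_on {0..L}"
    by (intro integrable_continuous_real continuous_intros cont)+
  have "continuous_on {0..L} (\<lambda>s. sin (\<theta> t s + \<kappa>))"
    by (intro continuous_intros cont)
  from integral_cyclic_shift[OF assms(1,2) this]
    Henstock_Kurzweil_Integration.integral_combine[OF \<open>0 \<le> L - a\<close> \<open>L - a \<le> L\<close> int(5)]
  show "sin_defect 0 (L - a) a \<kappa> t + sin_defect (L - a) L (a - L) (\<kappa> + 2 * pi * of_int \<omega>) t = 0"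
    unfolding sin_defect_def cos_sin_add_rotation integral_diff[OF int(1,2)] integral_diff[OF int(3,4)]
    using rotated closed[OF assms(3)] by linarith
qed

text \<open>At the cut \<open>L - a\<close> the shifted point is \<open>L\<close> for the first
  piece and 0 for the second; the extra angle 2 pi \<omega> compensates for the rotation, so both
  pieces give the same value there. The values at 0 and \<open>L\<close> agree in the same
  way.\<close>

lemma flux_terms_cancel:
  assumes "0 < t"
  shows "flux_term a \<kappa> t (L - a) - flux_term a \<kappa> t 0
    + (flux_term (a - L) (\<kappa> + 2 * pi * of_int \<omega>) t L
      - flux_term (a - L) (\<kappa> + 2 * pi * of_int \<omega>) t (L - a)) = 0"
  using assms by (simp add: flux_term_def boundary flux_periodic) (simp add: algebra_simps)

text \<open>Gronwall's inequality is applied to the sum of the two energies: the boundary terms and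
  defects of a single piece may be nonzero and cancel only in the sum.\<close>

lemma shift_invariance:
  assumes a: "0 < a" "a < L" and T: "0 \<le> T"
    and init1: "\<And>s. s \<in> {0..L - a} \<Longrightarrow> \<theta>\<^sub>0 (s + a) + \<kappa> = \<theta>\<^sub>0 s"
      "\<And>s. s \<in> {0..L - a} \<Longrightarrow> \<rho>\<^sub>0 (s + a) = \<rho>\<^sub>0 s"
    and init2: "\<And>s. s \<in> {L - a..L} \<Longrightarrow> \<theta>\<^sub>0 (s + (a - L)) + (\<kappa> + 2 * pi * of_int \<omega>) = \<theta>\<^sub>0 s"
      "\<And>s. s \<in> {L - a..L} \<Longrightarrow> \<rho>\<^sub>0 (s + (a - L)) = \<rho>\<^sub>0 s"
  shows "s \<in> {0..L - a} \<Longrightarrow> \<theta> T (s + a) + \<kappa> = \<theta> T s"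
    "s \<in> {0..L - a} \<Longrightarrow> \<rho> T (s + a) = \<rho> T s"
    "s \<in> {L - a..L} \<Longrightarrow> \<theta> T (s + (a - L)) + (\<kappa> + 2 * pi * of_int \<omega>) = \<theta> T s"
    "s \<in> {L - a..L} \<Longrightarrow> \<rho> T (s + (a - L)) = \<rho> T s"
proof -
  \<comment> \<open>On the second piece the argument falls back by one period, which costs the angle
    2 pi \<omega>; it is added back here.\<close>
  define \<kappa>' where "\<kappa>' = \<kappa> + 2 * pi * of_int \<omega>"
  define E1 where "E1 = energy 0 (L - a) a \<kappa>"
  define E2 where "E2 = energy (L - a) L (a - L) \<kappa>'"
  have p1: "0 \<le> (0::real)" "L - a \<le> L" "0 \<le> 0 + a" "L - a + a \<le> L"
    and p2: "0 \<le> L - a" "L \<le> L" "0 \<le> L - a + (a - L)" "L + (a - L) \<le> L"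
    and le: "0 \<le> L - a" "L - a \<le> L"
    using a by auto
  have cos_sin: "cos \<kappa>' = cos \<kappa>" "sin \<kappa>' = sin \<kappa>"
    using cos_sin_add_rotation[of 0 \<kappa>] by (simp_all add: \<kappa>'_def)
  obtain C where C: "\<And>t a b d \<kappa>. 0 < t \<Longrightarrow> t \<le> T \<Longrightarrow> a \<le> b \<Longrightarrow> 0 \<le> a \<Longrightarrow> b \<le> L \<Longrightarrow>
    0 \<le> a + d \<Longrightarrow> b + d \<le> L \<Longrightarrow>
    \<exists>D. (energy a b d \<kappa> has_real_derivative D) (at t) \<and>
      D \<le> flux_term d \<kappa> t b - flux_term d \<kappa> t a
        - (l1 t * cos \<kappa> - l2 t * sin \<kappa> - l1 t) * cos_defect a b d \<kappa> t
        - (l1 t * sin \<kappa> + l2 t * cos \<kappa> - l2 t) * sin_defect a b d \<kappa> t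
        + C * energy a b d \<kappa> t"
    using energy_rate[OF T] by blast
  have "E1 T + E2 T \<le> 0"
  proof (rule Gronwall_zero[where C = C and E = "\<lambda>t. E1 t + E2 t"])
    have "continuous_on {0..} (\<lambda>t. E1 t + E2 t)"
      unfolding E1_def E2_def
      by (intro continuous_on_add continuous_on_energy p1 p2)
    then show "continuous_on {0..T} (\<lambda>t. E1 t + E2 t)"
      by (rule continuous_on_subset) auto
    have "E1 0 = integral {0..L - a} (\<lambda>_. 0)"
      unfolding E1_def energy_def using a by (intro integral_cong) (simp add: initial init1)
    moreover have "E2 0 = integral {L - a..L} (\<lambda>_. 0)"
      unfolding E2_def energy_def \<kappa>'_def
      using a by (intro integral_cong) (simp add: initial init2)
    ultimately show "E1 0 + E2 0 \<le> 0" by simp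
    fix t assume t: "0 < t" "t < T"
    define m1 where "m1 = l1 t * cos \<kappa> - l2 t * sin \<kappa> - l1 t"
    define m2 where "m2 = l1 t * sin \<kappa> + l2 t * cos \<kappa> - l2 t"
    obtain D1 where D1: "(E1 has_real_derivative D1) (at t)"
      "D1 \<le> flux_term a \<kappa> t (L - a) - flux_term a \<kappa> t 0 - m1 * cos_defect 0 (L - a) a \<kappa> t
        - m2 * sin_defect 0 (L - a) a \<kappa> t + C * E1 t"
      using C[OF t(1) less_imp_le[OF t(2)] le(1) p1] unfolding E1_def m1_def m2_def by blast
    obtain D2 where D2: "(E2 has_real_derivative D2) (at t)"
      "D2 \<le> flux_term (a - L) \<kappa>' t L - flux_term (a - L) \<kappa>' t (L - a)
        - m1 * cos_defect (L - a) L (a - L) \<kappa>' t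
        - m2 * sin_defect (L - a) L (a - L) \<kappa>' t + C * E2 t"
      using C[OF t(1) less_imp_le[OF t(2)] le(2) p2, of \<kappa>']
      unfolding E2_def m1_def m2_def cos_sin by blast
    \<comment> \<open>The cosine and sine of \<open>\<kappa>'\<close> and \<open>\<kappa>\<close>
      agree, so both pieces carry the same factors \<open>m1\<close>, \<open>m2\<close> and their
      defects cancel.\<close>
    have "m1 * cos_defect 0 (L - a) a \<kappa> t + m1 * cos_defect (L - a) L (a - L) \<kappa>' t = 0"
      "m2 * sin_defect 0 (L - a) a \<kappa> t + m2 * sin_defect (L - a) L (a - L) \<kappa>' t = 0"
      using defects_cancel[of a t \<kappa>] a t unfolding \<kappa>'_def distrib_left[symmetric] by simp_all
    moreover note flux_terms_cancel[OF t(1), of a \<kappa>, folded \<kappa>'_def]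
    ultimately have "D1 + D2 \<le> C * (E1 t + E2 t)"
      using D1(2) D2(2) unfolding distrib_left by linarith
    then show "\<exists>D. ((\<lambda>t. E1 t + E2 t) has_real_derivative D) (at t) \<and> D \<le> C * (E1 t + E2 t)"
      using DERIV_add[OF D1(1) D2(1)] by blast
  qed fact
  then have zero: "energy 0 (L - a) a \<kappa> T = 0" "energy (L - a) L (a - L) \<kappa>' T = 0"
    using energy_nonneg[of 0 "L - a" a \<kappa> T] energy_nonneg[of "L - a" L "a - L" \<kappa>' T]
    unfolding E1_def E2_def by linarith+
  have lt: "0 < L - a" "L - a < L" using a by auto
  show "s \<in> {0..L - a} \<Longrightarrow> \<theta> T (s + a) + \<kappa> = \<theta> T s"
    "s \<in> {0..L - a} \<Longrightarrow> \<rho> T (s + a) = \<rho> T s"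
    using energy_zero_imp[OF lt(1) p1 T zero(1)] by blast+
  show "s \<in> {L - a..L} \<Longrightarrow> \<theta> T (s + (a - L)) + (\<kappa> + 2 * pi * of_int \<omega>) = \<theta> T s"
    "s \<in> {L - a..L} \<Longrightarrow> \<rho> T (s + (a - L)) = \<rho> T s"
    using energy_zero_imp[OF lt(2) p2 T zero(2)] unfolding \<kappa>'_def by blast+
qed

end

section \<open>Rotational symmetry along the flow\<close>

theorem proposition3p15:
  fixes L \<nu> \<mu> c\<^sub>0 :: real and \<omega> :: int and k :: nat
    and \<beta> \<theta>\<^sub>0 \<rho>\<^sub>0 :: "real \<Rightarrow> real" and \<theta> \<rho> :: "real \<Rightarrow> real \<Rightarrow> real"
  assumes "L > 0" and "\<mu> > 0"
    and "smooth_real \<beta>" and "\<And>x. \<beta> x > 0"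
    and "\<omega> = 1" and "k \<ge> 2"
    and "admissible_datum L \<nu> \<omega> \<theta>\<^sub>0 \<rho>\<^sub>0"
    and "flow_solution L \<mu> \<omega> c\<^sub>0 \<beta> \<theta>\<^sub>0 \<rho>\<^sub>0 \<theta> \<rho>"
    and "rotationally_symmetric L k \<theta>\<^sub>0 \<rho>\<^sub>0"
  shows "\<forall>t>0. rotationally_symmetric L k (\<theta> t) (\<rho> t)"
proof (intro allI impI)
  fix t :: real assume "0 < t"
  interpret closed_curve_flow L \<mu> c\<^sub>0 \<omega> \<beta> \<theta>\<^sub>0 \<rho>\<^sub>0 \<theta> \<rho>
    using assms by unfold_locales (auto simp: admissible_datum_def)
  define a where "a = L / real k"
  \<comment> \<open>Since \<open>a / L\<close> is 1/k, this is minus the phase 2 pi / k that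
    \<open>2 * pi * s / L\<close> gains under the shift by \<open>a\<close>.\<close>
  define \<kappa> where "\<kappa> = - (2 * pi * a / L)"
  have a: "0 < a" "a < L" using assms by (auto simp: a_def divide_simps)
  \<comment> \<open>For rotation number one, the phase lost by falling back one period is exactly
    the angle correction in \<open>shift_invariance\<close>.\<close>
  have phase: "2 * pi * (s + a) / L = 2 * pi * s / L - \<kappa>"
    "2 * pi * (s + (a - L)) / L = 2 * pi * s / L - (\<kappa> + 2 * pi * of_int \<omega>)" for s
    using L_pos \<open>\<omega> = 1\<close> by (simp_all add: \<kappa>_def field_simps)
  obtain g h where ext: "is_periodic_extension L (\<lambda>s. \<theta>\<^sub>0 s - 2 * pi * s / L) g"
      "is_periodic_extension L \<rho>\<^sub>0 h" and per: "\<And>s. g (s + a) = g s" "\<And>s. h (s + a) = h s"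
    using assms(9) unfolding rotationally_symmetric_def a_def by blast
  note \<theta>\<^sub>0 = periodic_extension_shift[OF ext(1) per(1) less_imp_le[OF a(1)] less_imp_le[OF a(2)]]
  note \<rho>\<^sub>0 = periodic_extension_shift[OF ext(2) per(2) less_imp_le[OF a(1)] less_imp_le[OF a(2)]]
  have init1: "\<theta>\<^sub>0 (s + a) + \<kappa> = \<theta>\<^sub>0 s" if "s \<in> {0..L - a}" for s
    using \<theta>\<^sub>0(1)[OF that] phase(1)[of s] by linarith
  have init2: "\<theta>\<^sub>0 (s + (a - L)) + (\<kappa> + 2 * pi * of_int \<omega>) = \<theta>\<^sub>0 s" if "s \<in> {L - a..L}" for s
    using \<theta>\<^sub>0(2)[OF that] phase(2)[of s] by linarith
  note inv = shift_invariance[OF a less_imp_le[OF \<open>0 < t\<close>] init1 \<rho>\<^sub>0(1) init2 \<rho>\<^sub>0(2)]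
  obtain g' where g': "is_periodic_extension L (\<lambda>s. \<theta> t s - 2 * pi * s / L) g'" "\<And>s. g' (s + a) = g' s"
  proof (rule periodic_extension_exists[OF a, of "\<lambda>s. \<theta> t s - 2 * pi * s / L"])
    show "\<theta> t L - 2 * pi * L / L = \<theta> t 0 - 2 * pi * 0 / L"
      using boundary(1)[OF \<open>0 < t\<close>] L_pos \<open>\<omega> = 1\<close> by simp
    show "\<theta> t (s + a) - 2 * pi * (s + a) / L = \<theta> t s - 2 * pi * s / L" if "s \<in> {0..L - a}" for s
      using inv(1)[OF _ _ _ _ that] phase(1)[of s] by simp
    show "\<theta> t (s + (a - L)) - 2 * pi * (s + (a - L)) / L = \<theta> t s - 2 * pi * s / L"
      if "s \<in> {L - a..L}" for s
      using inv(3)[OF _ _ _ _ that] phase(2)[of s] by simp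
  qed blast
  obtain h' where h': "is_periodic_extension L (\<rho> t) h'" "\<And>s. h' (s + a) = h' s"
    using periodic_extension_exists[OF a boundary(2)[OF \<open>0 < t\<close>]] inv(2,4) by blast
  show "rotationally_symmetric L k (\<theta> t) (\<rho> t)"
    unfolding rotationally_symmetric_def
    using smooth_strip_imp_smooth_interval[OF _ \<open>0 < t\<close>] smooth g' h' unfolding a_def by blast
qed

end
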